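(* For all integers $n,k\ge 1$, $$N_{n-1,k}(x)=\frac{1}{n!}\sum_{w\in\mathfrak{S}_n}B_w(x)\,E_{\ell_w,k}(x).$$
   Context: $\mathfrak{S}_n$ is the symmetric group on $\{1,\ldots,n\}$; permutations are written in one-line notation $w=w_1\cdots w_n$, and $\operatorname{des}(w)=|\{i:w_i>w_{i+1}\}|$. For $m,n\ge1$, $E_{m,n}(x)=\sum x^{\operatorname{des}(w)}$, where the sum is over all $w\in\mathfrak{S}_{m+n}$ with $w_1\le m$ and $w_{m+n}\ge m+1$. The type B Narayana polynomial is $B_n(x)=\sum_{k=0}^{n-1}\binom{n-1}{k}^2x^k$. For a permutation $w$ with cycle type $(\lambda_1,\ldots,\lambda_\ell)$ (fixed points counted as cycles), $\ell_w=\ell$ is the number of cycles of $w$ and $B_w(x)=B_{\lambda_1}(x)\cdots B_{\lambda_\ell}(x)$. The stack-sorting map $s:\mathfrak{S}_m\to\mathfrak{S}_m$ is defined as follows. Process the entries of $w$ from left to right with an initially empty stack. At each step, if the stack is empty or the next entry of $w$ is smaller than the top entry of the stack, push the next entry onto the stack; otherwise, pop the top entry of the stack to the end of the output. When all entries of $w$ have been pushed, pop the remaining stack entries one by one to the end of the output. The output is $s(w)$. For $n\ge 0$, $k\ge1$, let $\mathfrak{S}_{n,k}=\{w\in\mathfrak{S}_{n+k}: w_i=i\text{ for all }i>k\}$ and $N_{n,k}(x)=\sum_{w\in s^{-1}(\mathfrak{S}_{n,k})}x^{\operatorname{des}(w)}$. *)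

theory Defs
  imports
    "HOL-Combinatorics.Combinatorics"
    "HOL-Computational_Algebra.Polynomial"
begin

text \<open>
  The symmetric group on \<open>{1..n}\<close> is the set of functions \<open>w\<close> on the naturals with
  \<open>w permutes {1..n}\<close>; such a function is the identity outside \<open>{1..n}\<close>, so \<open>n\<close> is passed
  explicitly to every notion that depends on it.
\<close>

definition sym_group :: "nat \<Rightarrow> (nat \<Rightarrow> nat) set" where
  "sym_group n = {w. w permutes {1..n}}"

definition one_line :: "nat \<Rightarrow> (nat \<Rightarrow> nat) \<Rightarrow> nat list" where
  "one_line n w = map w [1..<Suc n]"

definition des :: "nat \<Rightarrow> (nat \<Rightarrow> nat) \<Rightarrow> nat" where
  "des n w = card {i. 1 \<le> i \<and> i < n \<and> w i > w (Suc i)}"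

definition E_poly :: "nat \<Rightarrow> nat \<Rightarrow> rat poly" where
  "E_poly m n =
     (\<Sum>w | w \<in> sym_group (m + n) \<and> w 1 \<le> m \<and> w (m + n) \<ge> m + 1. monom 1 (des (m + n) w))"

text \<open>Only used for \<open>n \<ge> 1\<close>.\<close>

definition narayana_B :: "nat \<Rightarrow> rat poly" where
  "narayana_B n = (\<Sum>k = 0..n - 1. monom (of_nat (((n - 1) choose k) ^ 2)) k)"

text \<open>
  The cycles of \<open>w\<close> are its orbits on \<open>{1..n}\<close>; a fixed point \<open>i\<close> contributes the orbit \<open>{i}\<close>.
\<close>

definition cycle_type :: "nat \<Rightarrow> (nat \<Rightarrow> nat) \<Rightarrow> nat multiset" where
  "cycle_type n w = image_mset card (mset_set (orbit w ` {1..n}))"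

definition num_cycles :: "nat \<Rightarrow> (nat \<Rightarrow> nat) \<Rightarrow> nat" where
  "num_cycles n w = size (cycle_type n w)"

definition B_perm :: "nat \<Rightarrow> (nat \<Rightarrow> nat) \<Rightarrow> rat poly" where
  "B_perm n w = prod_mset (image_mset narayana_B (cycle_type n w))"

text \<open>
  The first argument is the remaining input, the second the stack with its top entry first;
  the result is the output still to be produced. A pop emits its entry in front of the output
  of the rest of the run. Once the input is exhausted, the stack is emptied from the top.
\<close>

fun stack_run :: "nat list \<Rightarrow> nat list \<Rightarrow> nat list" where
  "stack_run [] st = st"
| "stack_run (a # inp) [] = stack_run inp [a]"
| "stack_run (a # inp) (t # st) =
     (if a < t then stack_run inp (a # t # st) else t # stack_run (a # inp) st)"

lemma mset_stack_run: "mset (stack_run inp st) = mset inp + mset st"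
  by (induction inp st rule: stack_run.induct) auto

definition stack_sort :: "nat \<Rightarrow> (nat \<Rightarrow> nat) \<Rightarrow> (nat \<Rightarrow> nat)" where
  "stack_sort m w =
     (\<lambda>i. if i \<in> {1..m} then stack_run (one_line m w) [] ! (i - 1) else i)"

lemma one_line_stack_sort: "one_line m (stack_sort m w) = stack_run (one_line m w) []"
proof -
  have "length (stack_run (one_line m w) []) = m"
    using arg_cong[OF mset_stack_run, of size "one_line m w" "[]"] by (simp add: one_line_def)
  then show ?thesis
    by (intro nth_equalityI) (auto simp: one_line_def stack_sort_def simp del: upt_Suc)
qed

lemma stack_sort_in_sym_group:
  assumes "w \<in> sym_group m"
  shows "stack_sort m w \<in> sym_group m"
proof -
  have w: "w permutes {1..m}"
    using assms by (simp add: sym_group_def)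
  have "mset (map (stack_sort m w) [1..<Suc m]) = mset (map w [1..<Suc m])"
    using one_line_stack_sort[of m w] mset_stack_run[of "one_line m w" "[]"]
    by (simp add: one_line_def)
  then have "mset (map (stack_sort m w) [1..<Suc m]) = mset [1..<Suc m]"
    using permutes_image_mset[OF w] by (simp add: atLeastLessThanSuc_atLeastAtMost del: upt_Suc)
  then have eq: "set (map (stack_sort m w) [1..<Suc m]) = set [1..<Suc m]"
    by (rule mset_eq_setD)
  then have im: "stack_sort m w ` {1..m} = {1..m}"
    by (simp add: atLeastLessThanSuc_atLeastAtMost del: upt_Suc)
  then have "bij_betw (stack_sort m w) {1..m} {1..m}"
    by (simp add: bij_betw_def eq_card_imp_inj_on)
  then show ?thesis
    unfolding sym_group_def by (auto intro!: bij_imp_permutes simp: stack_sort_def)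
qed

text \<open>Since \<open>w\<close> fixes everything above \<open>n + k\<close>, only the positions \<open>k < i \<le> n + k\<close> matter.\<close>

definition sym_fix :: "nat \<Rightarrow> nat \<Rightarrow> (nat \<Rightarrow> nat) set" where
  "sym_fix n k = {w \<in> sym_group (n + k). \<forall>i>k. w i = i}"

definition N_poly :: "nat \<Rightarrow> nat \<Rightarrow> rat poly" where
  "N_poly n k =
     (\<Sum>w | w \<in> sym_group (n + k) \<and> stack_sort (n + k) w \<in> sym_fix n k. monom 1 (des (n + k) w))"

end

theory Submission
  imports Defs "HOL-Library.Sublist" "HOL-Computational_Algebra.Formal_Power_Series"
begin

text \<open>
  Fix a rational \<open>x\<close> and let \<open>a(y) = \<Sum> A k * y ^ k / k!\<close>, \<open>k \<ge> 1\<close>, be the exponential generating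
  function of the Eulerian polynomials at \<open>x\<close>. Cutting a permutation counted by \<open>E m k\<close> after its first
  run of small and its first run of large entries shows that \<open>E\<^sub>k(y) = \<Sum> E m k * y ^ m / m!\<close> satisfies
  \<open>E\<^sub>k = a * (A k + x * (\<Sum>j = 1..<k. (k choose j) * A (k - j) * E\<^sub>j))\<close>. Splitting a permutation at its
  maximum \<open>M\<close>, where \<open>s(L M R) = s(L) s(R) M\<close>, shows that \<open>H\<^sub>k(z) = \<Sum> N (n - 1) k * z ^ n\<close> satisfies
  the same recurrence with \<open>a\<close> replaced by \<open>D / (1 - x * D)\<close>, where \<open>D = H\<^sub>0\<close> is a root of a quadratic
  polynomial.
  By the exponential formula the right-hand side is the coefficient of \<open>z ^ n\<close> in \<open>E\<^sub>k(\<beta>(z))\<close> with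
  \<open>\<beta>(z) = \<Sum> B n * z ^ n / n\<close>, so it remains to see \<open>a(\<beta>(z)) = D / (1 - x * D)\<close>, which follows by
  comparing differential equations.
\<close>

unbundle fps_syntax

section \<open>Permutations as lists\<close>

fun ldes :: "nat list \<Rightarrow> nat" where
  "ldes (a # b # xs) = (if b < a then 1 else 0) + ldes (b # xs)"
| "ldes _ = 0"

lemma ldes_append:
  "xs \<noteq> [] \<Longrightarrow> ys \<noteq> [] \<Longrightarrow> ldes (xs @ ys) = ldes xs + (if hd ys < last xs then 1 else 0) + ldes ys"
proof (induction xs rule: ldes.induct)
  case (1 a b xs)
  then show ?case by simp
next
  case ("2_2" v)
  then show ?case by (cases ys) auto
qed simp

lemma ldes_one_line: "ldes (one_line n w) = des n w"
proof (induction n)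
  case 0
  then show ?case by (simp add: one_line_def des_def)
next
  case (Suc n)
  show ?case
  proof (cases "n = 0")
    case True
    have "{i::nat. 1 \<le> i \<and> i < 1 \<and> w i > w (Suc i)} = {}" by auto
    then show ?thesis using True by (simp add: one_line_def des_def)
  next
    case False
    have split: "one_line (Suc n) w = one_line n w @ [w (Suc n)]" by (simp add: one_line_def)
    have ne: "one_line n w \<noteq> []" and last: "last (one_line n w) = w n"
      using False by (auto simp: one_line_def last_map)
    have set: "{i. 1 \<le> i \<and> i < Suc n \<and> w i > w (Suc i)} =
        {i. 1 \<le> i \<and> i < n \<and> w i > w (Suc i)} \<union> (if w (Suc n) < w n then {n} else {})"
      using False by (auto simp: less_Suc_eq)
    have "des (Suc n) w = des n w + (if w (Suc n) < w n then 1 else 0)"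
      unfolding des_def set by (subst card_Un_disjoint) auto
    then show ?thesis
      using Suc ne last by (simp add: split ldes_append)
  qed
qed

text \<open>Descents and stack runs are studied by cutting words into pieces over arbitrary finite
  sets; this bijection moves sums over functions to sums over words.\<close>

lemma bij_betw_one_line: "bij_betw (one_line n) (sym_group n) (permutations_of_set {1..n})"
proof (rule bij_betw_byWitness[where f' = "\<lambda>l i. if i \<in> {1..n} then l ! (i - 1) else i"])
  show "\<forall>w\<in>sym_group n. (\<lambda>i. if i \<in> {1..n} then one_line n w ! (i - 1) else i) = w"
    by (auto simp: sym_group_def one_line_def fun_eq_iff permutes_not_in simp del: upt_Suc)
  show "\<forall>l\<in>permutations_of_set {1..n}. one_line n (\<lambda>i. if i \<in> {1..n} then l ! (i - 1) else i) = l"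
  proof
    fix l assume "l \<in> permutations_of_set {1..n}"
    then have "length l = n" by (simp add: length_finite_permutations_of_set)
    then show "one_line n (\<lambda>i. if i \<in> {1..n} then l ! (i - 1) else i) = l"
      by (intro nth_equalityI) (auto simp: one_line_def simp del: upt_Suc)
  qed
  show "one_line n ` sym_group n \<subseteq> permutations_of_set {1..n}"
  proof
    fix l assume "l \<in> one_line n ` sym_group n"
    then obtain w where w: "w permutes {1..n}" and l: "l = map w [1..<Suc n]"
      by (auto simp: sym_group_def one_line_def)
    have "distinct l" using permutes_inj_on[OF w] by (simp add: l distinct_map del: upt_Suc)
    moreover have "set l = {1..n}" using permutes_image[OF w]
      by (simp add: l atLeastLessThanSuc_atLeastAtMost del: upt_Suc)
    ultimately show "l \<in> permutations_of_set {1..n}" by (simp add: permutations_of_set_def)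
  qed
  show "(\<lambda>l i. if i \<in> {1..n} then l ! (i - 1) else i) ` permutations_of_set {1..n} \<subseteq> sym_group n"
  proof (clarsimp simp only: sym_group_def image_subset_iff mem_Collect_eq)
    fix l assume l: "l \<in> permutations_of_set {1..n}"
    let ?f = "\<lambda>i. if i \<in> {1..n} then l ! (i - 1) else i"
    have len: "length l = n" using l by (simp add: length_finite_permutations_of_set)
    have "map ?f [1..<Suc n] = l"
      using len by (intro nth_equalityI) (auto simp del: upt_Suc)
    then have "?f ` set [1..<Suc n] = {1..n}"
      using permutations_of_setD(1)[OF l] by (metis set_map)
    then have "?f ` {1..n} = {1..n}"
      by (simp only: set_upt atLeastLessThanSuc_atLeastAtMost)
    then have "bij_betw ?f {1..n} {1..n}" by (simp add: bij_betw_def eq_card_imp_inj_on)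
    then show "?f permutes {1..n}" by (rule bij_imp_permutes) auto
  qed
qed

text \<open>A word is determined by the set \<open>T\<close> of letters to the right of
  \<open>M\<close> and the two words around \<open>M\<close>. As \<open>M\<close> occurs exactly
  once, \<open>takeWhile\<close> and \<open>dropWhile\<close> recover them.\<close>

lemma sum_permutations_insert:
  assumes "M \<notin> S" "finite S"
  shows "(\<Sum>l\<in>permutations_of_set (insert M S). f l) =
    (\<Sum>T\<in>Pow S. \<Sum>L\<in>permutations_of_set (S - T). \<Sum>R\<in>permutations_of_set T. f (L @ M # R))"
proof -
  have "(\<Sum>l\<in>permutations_of_set (insert M S). f l) =
    (\<Sum>(T, L, R)\<in>(SIGMA T:Pow S. permutations_of_set (S - T) \<times> permutations_of_set T). f (L @ M # R))"
  proof (rule sum.reindex_bij_witness[where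
      i = "\<lambda>(T, L, R). L @ M # R" and
      j = "\<lambda>l. (set (tl (dropWhile (\<lambda>y. y \<noteq> M) l)), takeWhile (\<lambda>y. y \<noteq> M) l, tl (dropWhile (\<lambda>y. y \<noteq> M) l))"])
    fix l assume l: "l \<in> permutations_of_set (insert M S)"
    then have "M \<in> set l" and dl: "distinct l" and sl: "set l = insert M S"
      by (auto simp: permutations_of_set_def)
    then obtain L R where LR: "l = L @ M # R" by (meson split_list)
    have tw: "takeWhile (\<lambda>y. y \<noteq> M) (L @ M # R) = L" "dropWhile (\<lambda>y. y \<noteq> M) (L @ M # R) = M # R"
      using dl by (auto simp: LR takeWhile_append dropWhile_append)
    have "set L \<union> set R = S" "set L \<inter> set R = {}"
      using dl sl assms(1) by (auto simp: LR)
    then have "set L = S - set R" "set R \<subseteq> S" by auto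
    then show "(case (set (tl (dropWhile (\<lambda>y. y \<noteq> M) l)), takeWhile (\<lambda>y. y \<noteq> M) l, tl (dropWhile (\<lambda>y. y \<noteq> M) l)) of
        (T, L, R) \<Rightarrow> L @ M # R) = l"
      and "(set (tl (dropWhile (\<lambda>y. y \<noteq> M) l)), takeWhile (\<lambda>y. y \<noteq> M) l, tl (dropWhile (\<lambda>y. y \<noteq> M) l))
        \<in> (SIGMA T:Pow S. permutations_of_set (S - T) \<times> permutations_of_set T)"
      and "(case (set (tl (dropWhile (\<lambda>y. y \<noteq> M) l)), takeWhile (\<lambda>y. y \<noteq> M) l, tl (dropWhile (\<lambda>y. y \<noteq> M) l)) of
        (T, L, R) \<Rightarrow> f (L @ M # R)) = f l"
      using dl by (auto simp: tw LR permutations_of_set_def)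
  next
    fix p assume p: "p \<in> (SIGMA T:Pow S. permutations_of_set (S - T) \<times> permutations_of_set T)"
    obtain T L R where [simp]: "p = (T, L, R)" by (cases p)
    have M: "\<And>y. y \<in> set L \<Longrightarrow> y \<noteq> M" using p assms(1) by (auto simp: permutations_of_set_def)
    have tw: "takeWhile (\<lambda>y. y \<noteq> M) (L @ M # R) = L" "dropWhile (\<lambda>y. y \<noteq> M) (L @ M # R) = M # R"
      using M by (auto simp: takeWhile_append dropWhile_append)
    show "(\<lambda>l. (set (tl (dropWhile (\<lambda>y. y \<noteq> M) l)), takeWhile (\<lambda>y. y \<noteq> M) l, tl (dropWhile (\<lambda>y. y \<noteq> M) l)))
        (case p of (T, L, R) \<Rightarrow> L @ M # R) = p"
      using p by (simp add: tw permutations_of_set_def)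
    show "(case p of (T, L, R) \<Rightarrow> L @ M # R) \<in> permutations_of_set (insert M S)"
      using p assms(1) by (auto simp: permutations_of_set_def)
  qed
  also have "\<dots> = (\<Sum>T\<in>Pow S. \<Sum>L\<in>permutations_of_set (S - T). \<Sum>R\<in>permutations_of_set T. f (L @ M # R))"
    using assms(2) by (subst sum.Sigma[symmetric]) (auto simp: sum.cartesian_product)
  finally show ?thesis .
qed

text \<open>Cut after the longest initial block \<open>S\<close> of letters from \<open>P\<close>.
  The block is nonempty because the first letter lies in \<open>P\<close>; its maximality is the
  condition that the rest \<open>Y\<close> is empty or begins in \<open>Q\<close>.\<close>

lemma sum_permutations_prefix:
  assumes "P \<inter> Q = {}" "finite P" "finite Q"
  shows "(\<Sum>l | l \<in> permutations_of_set (P \<union> Q) \<and> l \<noteq> [] \<and> hd l \<in> P. f l) =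
    (\<Sum>T\<in>Pow P - {{}}. \<Sum>S\<in>permutations_of_set T.
       \<Sum>Y | Y \<in> permutations_of_set ((P - T) \<union> Q) \<and> (Y = [] \<or> hd Y \<in> Q). f (S @ Y))"
proof -
  let ?Y = "\<lambda>T. {Y. Y \<in> permutations_of_set ((P - T) \<union> Q) \<and> (Y = [] \<or> hd Y \<in> Q)}"
  let ?p = "\<lambda>l. (set (takeWhile (\<lambda>y. y \<in> P) l), takeWhile (\<lambda>y. y \<in> P) l, dropWhile (\<lambda>y. y \<in> P) l)"
  have "(\<Sum>l | l \<in> permutations_of_set (P \<union> Q) \<and> l \<noteq> [] \<and> hd l \<in> P. f l) =
    (\<Sum>(T, S, Y)\<in>(SIGMA T:Pow P - {{}}. permutations_of_set T \<times> ?Y T). f (S @ Y))"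
  proof (rule sum.reindex_bij_witness[where i = "\<lambda>(T, S, Y). S @ Y" and j = ?p])
    fix l assume l: "l \<in> {l. l \<in> permutations_of_set (P \<union> Q) \<and> l \<noteq> [] \<and> hd l \<in> P}"
    define S where "S = takeWhile (\<lambda>y. y \<in> P) l"
    define Y where "Y = dropWhile (\<lambda>y. y \<in> P) l"
    have lS: "l = S @ Y" by (simp add: S_def Y_def)
    have SP: "set S \<subseteq> P" using set_takeWhileD by (fastforce simp: S_def)
    have "S \<noteq> []" using l by (cases l) (auto simp: S_def)
    have hdY: "Y = [] \<or> hd Y \<notin> P" using hd_dropWhile unfolding Y_def by blast
    have ds: "distinct (S @ Y)" "set S \<union> set Y = P \<union> Q"
      using l lS by (auto simp: permutations_of_set_def)
    have "set Y = (P - set S) \<union> Q" using ds SP assms(1) by auto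
    moreover have "Y = [] \<or> hd Y \<in> Q" using hdY ds(2) hd_in_set by blast
    ultimately have "?p l \<in> (SIGMA T:Pow P - {{}}. permutations_of_set T \<times> ?Y T)"
      using SP ds(1) \<open>S \<noteq> []\<close> by (auto simp: permutations_of_set_def S_def[symmetric] Y_def[symmetric])
    then show "?p l \<in> (SIGMA T:Pow P - {{}}. permutations_of_set T \<times> ?Y T)" .
    show "(case ?p l of (T, S, Y) \<Rightarrow> S @ Y) = l" "(case ?p l of (T, S, Y) \<Rightarrow> f (S @ Y)) = f l"
      by simp_all
  next
    fix p assume p: "p \<in> (SIGMA T:Pow P - {{}}. permutations_of_set T \<times> ?Y T)"
    obtain T S Y where [simp]: "p = (T, S, Y)" by (cases p)
    have SP: "\<And>y. y \<in> set S \<Longrightarrow> y \<in> P" "set S \<noteq> {}" using p by (auto simp: permutations_of_set_def)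
    have Y: "Y = [] \<or> hd Y \<notin> P" using p assms(1) by auto
    have "takeWhile (\<lambda>y. y \<in> P) (S @ Y) = S" "dropWhile (\<lambda>y. y \<in> P) (S @ Y) = Y"
      using SP Y by (cases Y; auto simp: takeWhile_append dropWhile_append)+
    then show "?p (case p of (T, S, Y) \<Rightarrow> S @ Y) = p"
      using p by (simp add: permutations_of_set_def)
    have "hd (S @ Y) \<in> P" using SP by (cases S) auto
    then show "(case p of (T, S, Y) \<Rightarrow> S @ Y) \<in> {l. l \<in> permutations_of_set (P \<union> Q) \<and> l \<noteq> [] \<and> hd l \<in> P}"
      using p SP assms(1) by (auto simp: permutations_of_set_def)
  qed
  also have "\<dots> = (\<Sum>T\<in>Pow P - {{}}. \<Sum>S\<in>permutations_of_set T. \<Sum>Y\<in>?Y T. f (S @ Y))"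
    using assms by (subst sum.Sigma[symmetric]) (auto simp: sum.cartesian_product intro: finite_subset)
  finally show ?thesis .
qed

lemma sum_Pow_card:
  assumes "finite S"
  shows "(\<Sum>T\<in>Pow S. f (card T)) = (\<Sum>i\<le>card S. of_nat (card S choose i) * f i)"
proof -
  have "(\<Sum>T\<in>Pow S. f (card T)) = (\<Sum>i\<le>card S. \<Sum>T | T \<in> Pow S \<and> card T = i. f (card T))"
    using assms by (intro sum.group[symmetric]) (auto intro: card_mono)
  also have "\<dots> = (\<Sum>i\<le>card S. of_nat (card S choose i) * f i)"
    using assms by (intro sum.cong refl) (simp add: n_subsets)
  finally show ?thesis .
qed

section \<open>The recurrence for stack-sorting preimages\<close>

text \<open>On arrival \<open>M\<close> exceeds every stack entry, so the whole stack is emptied,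
  which completes the output of \<open>L\<close>, and the run continues with \<open>M\<close> alone
  on the stack.\<close>

lemma stack_run_append_Max:
  "\<forall>y\<in>set L \<union> set st. y < M \<Longrightarrow>
    stack_run (L @ M # R) st = stack_run L st @ stack_run R [M]"
proof (induction L st rule: stack_run.induct)
  case (1 st)
  then show ?case by (induction st) auto
qed auto

text \<open>No later entry exceeds \<open>M\<close>, so it stays at the bottom until the final
  emptying and comes out last.\<close>

lemma stack_run_bottom:
  "\<forall>y\<in>set R. y < M \<Longrightarrow> stack_run R (st @ [M]) = stack_run R st @ [M]"
  by (induction R st rule: stack_run.induct) auto

lemma stack_run_Max:
  assumes "\<forall>y\<in>set L \<union> set R. y < M"
  shows "stack_run (L @ M # R) [] = stack_run L [] @ stack_run R [] @ [M]"
  using assms stack_run_append_Max[of L "[]" M R] stack_run_bottom[of R M "[]"] by simp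

lemma set_stack_run: "set (stack_run l []) = set l"
  using arg_cong[OF mset_stack_run, of set_mset l "[]"] by simp

lemma length_stack_run: "length (stack_run l []) = length l"
  using arg_cong[OF mset_stack_run, of size l "[]"] by simp

text \<open>\<open>M\<close> is entered by an ascent and left by a descent, the latter only if
  something follows.\<close>

lemma ldes_Max:
  assumes "\<forall>y\<in>set L \<union> set R. y < M"
  shows "ldes (L @ M # R) = ldes L + (if R = [] then 0 else 1) + ldes R"
proof -
  have "ldes (M # R) = (if R = [] then 0 else 1) + ldes R"
    using assms by (cases R) auto
  moreover have "ldes (L @ M # R) = ldes L + ldes (M # R)"
  proof (cases "L = []")
    case False
    then have "last L < M" using assms by auto
    then show ?thesis using False by (simp add: ldes_append)
  qed simp
  ultimately show ?thesis by simp
qed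

lemma sum_sum_product:
  fixes c :: "'a::comm_semiring_0"
  shows "(\<Sum>i\<in>A. \<Sum>j\<in>B. f i * (c * g j)) = sum f A * (c * sum g B)"
  by (simp only: sum_distrib_left[symmetric] sum_distrib_right[symmetric])

text \<open>In the intended case every element of \<open>P\<close> is below every element of
  \<open>B\<close>: the elements of \<open>P\<close> are free, those of \<open>B\<close> must end
  the output in increasing order. Arbitrary sets are allowed because splitting at the maximum
  produces subsets. For empty \<open>B\<close> the constraint disappears and the Eulerian polynomial
  on \<open>P\<close> remains.\<close>

definition stack_sum :: "'a::comm_ring_1 \<Rightarrow> nat set \<Rightarrow> nat set \<Rightarrow> 'a" where
  "stack_sum x P B =
    (\<Sum>l | l \<in> permutations_of_set (P \<union> B) \<and> suffix (sorted_list_of_set B) (stack_run l []). x ^ ldes l)"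

text \<open>\<open>stack_numb x n k\<close> is the value of \<open>N_{n,k}\<close> at
  \<open>x\<close>, and \<open>stack_numb x 0 k\<close> is the Eulerian value \<open>A k\<close> of
  the overview.\<close>

definition stack_numb :: "'a::comm_ring_1 \<Rightarrow> nat \<Rightarrow> nat \<Rightarrow> 'a" where
  "stack_numb x n k = stack_sum x {1..k} {k + 1..k + n}"

lemma stack_sum_empty: "stack_sum x P {} = (\<Sum>l\<in>permutations_of_set P. x ^ ldes l)"
  by (simp add: stack_sum_def)

lemma stack_numb_0_0: "stack_numb x 0 0 = 1"
  by (simp add: stack_numb_def stack_sum_def)

text \<open>The unconstrained split at the maximum: \<open>T\<close> is the set of entries after
  \<open>M\<close>, and the factor \<open>x\<close> records the descent leaving
  \<open>M\<close>.\<close>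

lemma eulerian_sum_insert:
  assumes "finite P" "\<forall>p\<in>P. p < M"
  shows "stack_sum x (insert M P) {} =
    (\<Sum>T\<in>Pow P. stack_sum x (P - T) {} * (if T = {} then 1 else x) * stack_sum x T {})"
proof -
  have "(\<Sum>l\<in>permutations_of_set (insert M P). x ^ ldes l) =
    (\<Sum>T\<in>Pow P. \<Sum>L\<in>permutations_of_set (P - T). \<Sum>R\<in>permutations_of_set T. x ^ ldes (L @ M # R))"
    using assms by (intro sum_permutations_insert) auto
  also have "\<dots> = (\<Sum>T\<in>Pow P. \<Sum>L\<in>permutations_of_set (P - T). \<Sum>R\<in>permutations_of_set T.
      x ^ ldes L * ((if T = {} then 1 else x) * x ^ ldes R))"
  proof (intro sum.cong refl)
    fix T L R assume *: "T \<in> Pow P" "L \<in> permutations_of_set (P - T)" "R \<in> permutations_of_set T"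
    then have "\<forall>y\<in>set L \<union> set R. y < M" "R = [] \<longleftrightarrow> T = {}"
      using assms(2) by (auto simp: permutations_of_set_def)
    then show "x ^ ldes (L @ M # R) = x ^ ldes L * ((if T = {} then 1 else x) * x ^ ldes R)"
      by (simp add: ldes_Max power_add)
  qed
  finally show ?thesis
    by (simp add: stack_sum_empty sum_sum_product mult.assoc)
qed

lemma suffix_append_same_length:
  assumes "length v = length c"
  shows "suffix (u @ v) (a @ c) \<longleftrightarrow> suffix u a \<and> v = c"
  using assms by (auto simp: suffix_def append.assoc[symmetric] simp del: append_assoc)

text \<open>
  With \<open>M\<close> the maximum of \<open>L @ M # R\<close>, the sorted tail \<open>B\<close> of the output lies either inside the output of \<open>R\<close>
  (first sum) or \<open>R\<close> consists of the largest elements of \<open>B\<close> and is itself sorted (second sum).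
\<close>

lemma stack_sum_insert:
  assumes fin: "finite P" "finite B" and PB: "\<forall>p\<in>P. \<forall>q\<in>B. p < q" and M: "\<forall>p\<in>P \<union> B. p < M"
  defines "b \<equiv> sorted_list_of_set B"
  shows "stack_sum x P (insert M B) =
    (\<Sum>Q\<in>Pow P. stack_sum x (P - Q) {} * (if Q \<union> B = {} then 1 else x) * stack_sum x Q B) +
    (\<Sum>i = 1..card B. stack_sum x P (set (take i b)) * (if i = card B then 1 else x) * stack_sum x {} (set (drop i b)))"
proof -
  let ?S = "P \<union> B"
  let ?s = "\<lambda>l. stack_run l []"
  define w where "w = (\<lambda>T :: nat set. if T = {} then 1 else x)"
  define h where "h = (\<lambda>T. \<Sum>L\<in>permutations_of_set (?S - T). \<Sum>R\<in>permutations_of_set T.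
      if suffix b (?s L @ ?s R) then x ^ ldes L * (w T * x ^ ldes R) else 0)"
  have PB_disj: "P \<inter> B = {}" using PB less_irrefl by blast
  have b: "sorted b" "distinct b" "set b = B" "length b = card B"
    using fin by (simp_all add: b_def)
  \<comment> \<open>\<open>M\<close> always ends the output and matches the last letter of the
    sorted tail, so the condition becomes one on \<open>b\<close> and
    \<open>s(L) s(R)\<close>.\<close>
  have "sorted_list_of_set (set (b @ [M])) = b @ [M]"
    using b M by (intro sorted_list_of_set.idem_if_sorted_distinct) (auto simp: sorted_append less_imp_le)
  then have bM: "sorted_list_of_set (insert M B) = b @ [M]" by (simp add: b(3))
  have "stack_sum x P (insert M B) = (\<Sum>l\<in>permutations_of_set (insert M ?S).
      if suffix (b @ [M]) (?s l) then x ^ ldes l else 0)"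
    by (simp add: stack_sum_def bM sum.inter_filter)
  also have "\<dots> = (\<Sum>T\<in>Pow ?S. \<Sum>L\<in>permutations_of_set (?S - T). \<Sum>R\<in>permutations_of_set T.
      if suffix (b @ [M]) (?s (L @ M # R)) then x ^ ldes (L @ M # R) else 0)"
    using fin M by (intro sum_permutations_insert) auto
  also have "\<dots> = (\<Sum>T\<in>Pow ?S. h T)"
    unfolding h_def
  proof (intro sum.cong refl)
    fix T L R assume *: "T \<in> Pow ?S" "L \<in> permutations_of_set (?S - T)" "R \<in> permutations_of_set T"
    then have lt: "\<forall>y\<in>set L \<union> set R. y < M" and "R = [] \<longleftrightarrow> T = {}"
      using M by (auto simp: permutations_of_set_def)
    moreover have "suffix (b @ [M]) (?s (L @ M # R)) \<longleftrightarrow> suffix b (?s L @ ?s R)"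
      using suffix_append_same_length[of "[M]" "[M]" b "?s L @ ?s R"] by (simp add: stack_run_Max[OF lt])
    ultimately show "(if suffix (b @ [M]) (?s (L @ M # R)) then x ^ ldes (L @ M # R) else 0) =
      (if suffix b (?s L @ ?s R) then x ^ ldes L * (w T * x ^ ldes R) else 0)"
      by (simp add: ldes_Max power_add w_def)
  qed
  \<comment> \<open>Only two kinds of \<open>T\<close> contribute: either \<open>b\<close> lies
    inside \<open>s(R)\<close>, whence \<open>B \<subseteq> T\<close>, or \<open>s(R)\<close> is a
    proper final piece of \<open>b\<close>. The index starts at 1 because \<open>i = 0\<close> would
    give \<open>T = B\<close>, already present with \<open>Q = {}\<close>.\<close>
  also have "\<dots> = (\<Sum>T\<in>(\<lambda>Q. Q \<union> B) ` Pow P \<union> (\<lambda>i. set (drop i b)) ` {1..card B}. h T)"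
  proof (rule sum.mono_neutral_right)
    show "(\<lambda>Q. Q \<union> B) ` Pow P \<union> (\<lambda>i. set (drop i b)) ` {1..card B} \<subseteq> Pow ?S"
      using b(3) by (auto dest: in_set_dropD)
    show "\<forall>T\<in>Pow ?S - ((\<lambda>Q. Q \<union> B) ` Pow P \<union> (\<lambda>i. set (drop i b)) ` {1..card B}). h T = 0"
    proof
      fix T assume T: "T \<in> Pow ?S - ((\<lambda>Q. Q \<union> B) ` Pow P \<union> (\<lambda>i. set (drop i b)) ` {1..card B})"
      have "\<not> suffix b (?s L @ ?s R)"
        if "L \<in> permutations_of_set (?S - T)" "R \<in> permutations_of_set T" for L R
      proof
        assume "suffix b (?s L @ ?s R)"
        then have "suffix b (?s R) \<or> (\<exists>b'. b = b' @ ?s R)"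
          unfolding suffix_append by blast
        then consider "suffix b (?s R)" | b' where "b = b' @ ?s R" "b' \<noteq> []"
          by (metis append_Nil suffix_order.refl)
        then show False
        proof cases
          case 1
          then have "B \<subseteq> T" using set_mono_suffix[OF 1] that b(3)
            by (simp add: set_stack_run permutations_of_set_def)
          then have "T = (T \<inter> P) \<union> B" using T by auto
          then show False using T by blast
        next
          case 2
          then have "T = set (drop (length b') b)"
            using that by (simp add: set_stack_run permutations_of_set_def)
          moreover have "length b' \<in> {1..card B}"
            using 2 b(4) by (cases b') auto
          ultimately show False using T by blast
        qed
      qed
      then show "h T = 0" by (simp add: h_def)
    qed
  qed (use fin in auto)
  also have "\<dots> = (\<Sum>T\<in>(\<lambda>Q. Q \<union> B) ` Pow P. h T) + (\<Sum>T\<in>(\<lambda>i. set (drop i b)) ` {1..card B}. h T)"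
  proof (rule sum.union_disjoint)
    \<comment> \<open>The two families are separated by size: the sets of the second have fewer than
      \<open>card B\<close> elements.\<close>
    have lt: "card (set (drop i b)) < card B" if "i \<in> {1..card B}" for i
      using that b by (simp add: distinct_card)
    have le: "card B \<le> card (Q \<union> B)" if "Q \<subseteq> P" for Q
      using that fin by (intro card_mono) (auto intro: finite_subset)
    show "(\<lambda>Q. Q \<union> B) ` Pow P \<inter> (\<lambda>i. set (drop i b)) ` {1..card B} = {}"
    proof (rule equals0I)
      fix T assume "T \<in> (\<lambda>Q. Q \<union> B) ` Pow P \<inter> (\<lambda>i. set (drop i b)) ` {1..card B}"
      then obtain Q i where "Q \<subseteq> P" "i \<in> {1..card B}" and T: "T = Q \<union> B" "T = set (drop i b)"
        by blast
      have "card T < card B" unfolding T(2) by (rule lt) fact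
      moreover have "card B \<le> card T" unfolding T(1) by (rule le) fact
      ultimately show False by simp
    qed
  qed (use fin in auto)
  also have "(\<Sum>T\<in>(\<lambda>Q. Q \<union> B) ` Pow P. h T) = (\<Sum>Q\<in>Pow P. h (Q \<union> B))"
  proof (rule sum.reindex_cong[OF _ refl refl], rule inj_on_inverseI[where g = "\<lambda>T. T - B"])
    show "Q \<union> B - B = Q" if "Q \<in> Pow P" for Q using that PB_disj by blast
  qed
  also have "\<dots> = (\<Sum>Q\<in>Pow P. stack_sum x (P - Q) {} * (if Q \<union> B = {} then 1 else x) * stack_sum x Q B)"
  proof (intro sum.cong refl)
    fix Q assume Q: "Q \<in> Pow P"
    have S: "?S - (Q \<union> B) = P - Q" using PB_disj Q by blast
    have "h (Q \<union> B) = (\<Sum>L\<in>permutations_of_set (P - Q). \<Sum>R\<in>permutations_of_set (Q \<union> B).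
        x ^ ldes L * (w (Q \<union> B) * (if suffix b (?s R) then x ^ ldes R else 0)))"
      unfolding h_def S
    proof (intro sum.cong refl)
      fix L R assume *: "L \<in> permutations_of_set (P - Q)" "R \<in> permutations_of_set (Q \<union> B)"
      have "length b \<le> length (?s R)"
        using * fin Q card_mono[of "Q \<union> B" B] b(4)
        by (simp add: length_stack_run length_finite_permutations_of_set finite_subset)
      then have "suffix b (?s L @ ?s R) \<longleftrightarrow> suffix b (?s R)"
        by (metis suffixI suffix_appendI suffix_length_suffix)
      then show "(if suffix b (?s L @ ?s R) then x ^ ldes L * (w (Q \<union> B) * x ^ ldes R) else 0) =
        x ^ ldes L * (w (Q \<union> B) * (if suffix b (?s R) then x ^ ldes R else 0))" by simp
    qed
    then show "h (Q \<union> B) = stack_sum x (P - Q) {} * (if Q \<union> B = {} then 1 else x) * stack_sum x Q B"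
      by (simp add: stack_sum_empty stack_sum_def[of x Q B] b_def[symmetric] sum.inter_filter w_def
        sum_sum_product mult.assoc)
  qed
  also have "(\<Sum>T\<in>(\<lambda>i. set (drop i b)) ` {1..card B}. h T) = (\<Sum>i = 1..card B. h (set (drop i b)))"
  proof (rule sum.reindex_cong[OF _ refl refl], rule inj_onI)
    fix i j assume "i \<in> {1..card B}" "j \<in> {1..card B}" "set (drop i b) = set (drop j b)"
    then have "card B - i = card B - j" "i \<le> card B" "j \<le> card B"
      using b distinct_card[of "drop i b"] distinct_card[of "drop j b"] by simp_all
    then show "i = j" by (simp add: eq_diff_iff)
  qed
  also have "\<dots> = (\<Sum>i = 1..card B. stack_sum x P (set (take i b)) * (if i = card B then 1 else x) * stack_sum x {} (set (drop i b)))"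
  proof (intro sum.cong refl)
    fix i assume i: "i \<in> {1..card B}"
    let ?T = "set (drop i b)"
    have disj: "set (take i b) \<inter> ?T = {}" using b(2) by (simp add: set_take_disj_set_drop_if_distinct)
    have un: "set (take i b) \<union> ?T = B" using b(3) by (metis append_take_drop_id set_append)
    have S: "?S - ?T = P \<union> set (take i b)" using disj un PB_disj by blast
    have srt: "sorted_list_of_set (set (take i b)) = take i b" "sorted_list_of_set ?T = drop i b"
      using b by (simp_all add: sorted_list_of_set.idem_if_sorted_distinct sorted_wrt_take sorted_wrt_drop)
    have T0: "?T = {} \<longleftrightarrow> i = card B" using i b(4) by auto
    have "h ?T = (\<Sum>L\<in>permutations_of_set (P \<union> set (take i b)). \<Sum>R\<in>permutations_of_set ?T.
        (if suffix (take i b) (?s L) then x ^ ldes L else 0) * (w ?T * (if suffix (drop i b) (?s R) then x ^ ldes R else 0)))"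
      unfolding h_def S
    proof (intro sum.cong refl)
      fix L R assume *: "R \<in> permutations_of_set ?T"
      have len: "length (drop i b) = length (?s R)"
        using * b(2) distinct_card[of "drop i b"] by (simp add: length_stack_run length_finite_permutations_of_set)
      have "suffix b (?s L @ ?s R) \<longleftrightarrow> suffix (take i b) (?s L) \<and> drop i b = ?s R"
        using suffix_append_same_length[OF len, of "take i b" "?s L"] by simp
      moreover have "drop i b = ?s R \<longleftrightarrow> suffix (drop i b) (?s R)"
        using len suffix_append_same_length[OF len, of "[]" "[]"] by simp
      ultimately show "(if suffix b (?s L @ ?s R) then x ^ ldes L * (w ?T * x ^ ldes R) else 0) =
        (if suffix (take i b) (?s L) then x ^ ldes L else 0) * (w ?T * (if suffix (drop i b) (?s R) then x ^ ldes R else 0))"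
        by simp
    qed
    also have "\<dots> = stack_sum x P (set (take i b)) * (w ?T * stack_sum x {} ?T)"
      by (simp add: stack_sum_def srt sum.inter_filter sum_sum_product)
    finally show "h ?T = stack_sum x P (set (take i b)) * (if i = card B then 1 else x) * stack_sum x {} ?T"
      using T0 by (simp add: w_def mult.assoc)
  qed
  finally show ?thesis .
qed

text \<open>The split at the maximum in terms of cardinalities. In the last equation
  \<open>j\<close> counts the free entries right of the maximum, and \<open>r\<close> is the size of
  a right part consisting only of top elements of the tail. There every term first gets
  \<open>x\<close> for the descent after the maximum; the summand with \<open>1 - x\<close> corrects
  the single split with empty right part.\<close>

fun stack_rhs :: "'a::comm_ring_1 \<Rightarrow> nat \<Rightarrow> nat \<Rightarrow> 'a" where
  "stack_rhs x 0 0 = 1"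
| "stack_rhs x 0 (Suc n) = (\<Sum>i\<le>n. of_nat (n choose i) * (stack_numb x 0 (n - i) * (if i = 0 then 1 else x) * stack_numb x 0 i))"
| "stack_rhs x (Suc n) k = x * (\<Sum>j\<le>k. of_nat (k choose j) * (stack_numb x 0 (k - j) * stack_numb x n j))
     + x * (\<Sum>r<n. stack_numb x r 0 * stack_numb x (n - r) k) + (1 - x) * stack_numb x n k"

text \<open>The induction hypothesis says that smaller sums depend on cardinalities only. The step
  is used twice: to establish that dependence in general, and then on intervals to obtain the
  recurrence itself.\<close>

lemma stack_sum_step:
  assumes fin: "finite P" "finite B" and PB: "\<forall>p\<in>P. \<forall>q\<in>B. p < q"
    and IH: "\<And>P' B'. finite P' \<Longrightarrow> finite B' \<Longrightarrow> \<forall>p\<in>P'. \<forall>q\<in>B'. p < q \<Longrightarrow>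
      card P' + card B' < card P + card B \<Longrightarrow> stack_sum x P' B' = stack_numb x (card B') (card P')"
  shows "stack_sum x P B = stack_rhs x (card B) (card P)"
proof (cases "B = {}")
  case B: True
  show ?thesis
  proof (cases "P = {}")
    case True
    then show ?thesis using B by (simp add: stack_sum_def)
  next
    case False
    define M where "M = Max P"
    define P' where "P' = P - {M}"
    have MP: "M \<in> P" using False fin by (simp add: M_def)
    have P': "P = insert M P'" "M \<notin> P'" "finite P'" "\<forall>p\<in>P'. p < M"
      using MP fin by (auto simp: P'_def M_def less_le)
    have c: "card P = Suc (card P')" using P' by simp
    have "stack_sum x P B = (\<Sum>T\<in>Pow P'. stack_sum x (P' - T) {} * (if T = {} then 1 else x) * stack_sum x T {})"
      using eulerian_sum_insert[OF P'(3,4)] by (simp add: B P'(1))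
    also have "\<dots> = (\<Sum>T\<in>Pow P'. (\<lambda>i. stack_numb x 0 (card P' - i) * (if i = 0 then 1 else x) * stack_numb x 0 i) (card T))"
    proof (intro sum.cong refl)
      fix T assume T: "T \<in> Pow P'"
      then have fT: "finite T" and le: "card T \<le> card P'"
        using P'(3) finite_subset card_mono by auto
      have "card (P' - T) = card P' - card T" using T fT by (simp add: card_Diff_subset)
      then show "stack_sum x (P' - T) {} * (if T = {} then 1 else x) * stack_sum x T {} =
        (\<lambda>i. stack_numb x 0 (card P' - i) * (if i = 0 then 1 else x) * stack_numb x 0 i) (card T)"
        using IH[of "P' - T" "{}"] IH[of T "{}"] fT le P'(3) by (simp add: c B)
    qed
    finally show ?thesis
      by (subst (asm) sum_Pow_card[OF P'(3)]) (simp add: B c)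
  qed
next
  case False
  define M where "M = Max B"
  define B' where "B' = B - {M}"
  have MB: "M \<in> B" using False fin by (simp add: M_def)
  have B': "B = insert M B'" "M \<notin> B'" "finite B'" "\<forall>p\<in>B'. p < M"
    using MB fin by (auto simp: B'_def M_def less_le)
  define n where "n = card B'"
  have c: "card B = Suc n" using B' by (simp add: n_def)
  define b where "b = sorted_list_of_set B'"
  have b: "distinct b" "set b = B'" "length b = n"
    using B'(3) by (simp_all add: b_def n_def)
  have PB': "\<forall>p\<in>P. \<forall>q\<in>B'. p < q" using PB B'(1) by auto
  have S: "stack_sum x P B =
    (\<Sum>Q\<in>Pow P. stack_sum x (P - Q) {} * (if Q \<union> B' = {} then 1 else x) * stack_sum x Q B') +
    (\<Sum>i = 1..n. stack_sum x P (set (take i b)) * (if i = n then 1 else x) * stack_sum x {} (set (drop i b)))"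
    unfolding B'(1) b_def n_def using PB MB B'(4) by (intro stack_sum_insert fin(1) B'(3) PB') auto
  have "(\<Sum>Q\<in>Pow P. stack_sum x (P - Q) {} * (if Q \<union> B' = {} then 1 else x) * stack_sum x Q B') =
    (\<Sum>Q\<in>Pow P. (\<lambda>j. stack_numb x 0 (card P - j) * (if j + n = 0 then 1 else x) * stack_numb x n j) (card Q))"
  proof (intro sum.cong refl)
    fix Q assume Q: "Q \<in> Pow P"
    then have fQ: "finite Q" and le: "card Q \<le> card P"
      using fin finite_subset card_mono by auto
    have "card (P - Q) = card P - card Q" using Q fQ by (simp add: card_Diff_subset)
    moreover have "Q \<union> B' = {} \<longleftrightarrow> card Q + n = 0" using fQ B'(3) by (simp add: n_def)
    moreover have "stack_sum x Q B' = stack_numb x n (card Q)"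
      using IH[of Q B'] fQ B'(3) le PB' Q by (auto simp: c n_def)
    ultimately show "stack_sum x (P - Q) {} * (if Q \<union> B' = {} then 1 else x) * stack_sum x Q B' =
      (\<lambda>j. stack_numb x 0 (card P - j) * (if j + n = 0 then 1 else x) * stack_numb x n j) (card Q)"
      using IH[of "P - Q" "{}"] fin(1) by (simp add: c)
  qed
  also have "\<dots> = (\<Sum>j\<le>card P. of_nat (card P choose j) *
      (stack_numb x 0 (card P - j) * (if j + n = 0 then 1 else x) * stack_numb x n j))"
    by (rule sum_Pow_card[OF fin(1)])
  finally have S1: "(\<Sum>Q\<in>Pow P. stack_sum x (P - Q) {} * (if Q \<union> B' = {} then 1 else x) * stack_sum x Q B') = \<dots>" .
  \<comment> \<open>Reindexed by \<open>r = n - i\<close>, the size of the right part;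
    \<open>r = 0\<close> is the case with nothing after the maximum.\<close>
  have S2: "(\<Sum>i = 1..n. stack_sum x P (set (take i b)) * (if i = n then 1 else x) * stack_sum x {} (set (drop i b))) =
    (\<Sum>r<n. stack_numb x (n - r) (card P) * (if r = 0 then 1 else x) * stack_numb x r 0)"
  proof (rule sum.reindex_bij_witness[where i = "\<lambda>r. n - r" and j = "\<lambda>i. n - i"])
    fix i assume i: "i \<in> {1..n}"
    have cards: "card (set (take i b)) = i" "card (set (drop i b)) = n - i"
      using i b by (simp_all add: distinct_card)
    have "stack_sum x P (set (take i b)) = stack_numb x i (card P)"
      using IH[of P "set (take i b)"] fin(1) PB' b(2) i cards by (auto simp: c dest: in_set_takeD)
    moreover have "stack_sum x {} (set (drop i b)) = stack_numb x (n - i) 0"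
      using IH[of "{}" "set (drop i b)"] i cards by (simp add: c)
    ultimately show "stack_numb x (n - (n - i)) (card P) * (if n - i = 0 then 1 else x) * stack_numb x (n - i) 0 =
      stack_sum x P (set (take i b)) * (if i = n then 1 else x) * stack_sum x {} (set (drop i b))"
      using i by auto
  qed auto
  show ?thesis
  \<comment> \<open>The split without a descent is the term \<open>j = 0\<close> of the first sum if
    \<open>n = 0\<close>, when the second sum is empty, and the term \<open>r = 0\<close> of the
    second sum otherwise. Writing its weight as \<open>x + (1 - x)\<close> gives the
    correction.\<close>
  proof (cases "n = 0")
    case True
    have "(\<Sum>j\<le>card P. of_nat (card P choose j) *
      (stack_numb x 0 (card P - j) * (if j + n = 0 then 1 else x) * stack_numb x n j)) =
      (\<Sum>j\<le>card P. x * (of_nat (card P choose j) * (stack_numb x 0 (card P - j) * stack_numb x n j)) +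
        (if j = 0 then (1 - x) * stack_numb x 0 (card P) else 0))"
      using True by (intro sum.cong refl) (simp add: stack_numb_0_0 algebra_simps)
    then show ?thesis
      unfolding S S1 S2 c using True by (simp add: sum.distrib sum_distrib_left)
  next
    case False
    have "(\<Sum>r<n. stack_numb x (n - r) (card P) * (if r = 0 then 1 else x) * stack_numb x r 0) =
      (\<Sum>r<n. x * (stack_numb x r 0 * stack_numb x (n - r) (card P)) +
        (if r = 0 then (1 - x) * stack_numb x n (card P) else 0))"
      by (intro sum.cong refl) (simp add: stack_numb_0_0 algebra_simps)
    then show ?thesis
      unfolding S S1 S2 c using False by (simp add: sum.distrib sum_distrib_left mult_ac)
  qed
qed

text \<open>The given sets and the intervals of the same sizes both attain the value of
  \<open>stack_rhs\<close> at these sizes; invariance under relabelling thus follows from the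
  recurrence, without an order isomorphism.\<close>

lemma stack_sum_card:
  assumes "finite P" "finite B" "\<forall>p\<in>P. \<forall>q\<in>B. p < q"
  shows "stack_sum x P B = stack_numb x (card B) (card P)"
  using assms
proof (induction "card P + card B" arbitrary: P B rule: less_induct)
  case less
  have "stack_sum x P' B' = stack_rhs x (card B') (card P')"
    if "finite P'" "finite B'" "\<forall>p\<in>P'. \<forall>q\<in>B'. p < q" "card P' + card B' = card P + card B" for P' B'
    using that less.hyps by (intro stack_sum_step) auto
  from this[of P B] this[of "{1..card P}" "{card P + 1..card P + card B}"] less.prems
  show ?case by (simp add: stack_numb_def)
qed

lemma stack_numb_rec: "stack_numb x n k = stack_rhs x n k"
proof -
  have "stack_sum x {1..k} {k + 1..k + n} = stack_rhs x (card {k + 1..k + n}) (card {1..k})"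
    by (rule stack_sum_step) (auto intro: stack_sum_card)
  then show ?thesis by (simp add: stack_numb_def)
qed

section \<open>The recurrence for alternating runs of small and large entries\<close>

text \<open>The sum behind \<open>E_{m,k}(x)\<close> for arbitrary sets, with \<open>P\<close> meant
  to lie below \<open>Q\<close>; \<open>alt_numb x m k\<close> is the value of
  \<open>E_{m,k}\<close> at \<open>x\<close>.\<close>

definition alt_sum :: "'a::comm_ring_1 \<Rightarrow> nat set \<Rightarrow> nat set \<Rightarrow> 'a" where
  "alt_sum x P Q = (\<Sum>l | l \<in> permutations_of_set (P \<union> Q) \<and> l \<noteq> [] \<and> hd l \<in> P \<and> last l \<in> Q. x ^ ldes l)"

definition alt_numb :: "'a::comm_ring_1 \<Rightarrow> nat \<Rightarrow> nat \<Rightarrow> 'a" where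
  "alt_numb x m k = alt_sum x {1..m} {m + 1..m + k}"

lemma alt_sum_empty_right: "alt_sum x P {} = 0"
  by (simp add: alt_sum_def)

text \<open>Cut after the first run \<open>S\<close> of small entries. The rest contains
  \<open>Q\<close>, hence is nonempty, and starts with a large entry; the cut is an ascent, so the
  weights of the two pieces multiply.\<close>

lemma alt_sum_prefix_small:
  assumes fin: "finite P" "finite Q" and PQ: "\<forall>p\<in>P. \<forall>q\<in>Q. p < q" and "Q \<noteq> {}"
  shows "alt_sum x P Q = (\<Sum>T\<in>Pow P - {{}}. stack_sum x T {} *
    (\<Sum>Y | Y \<in> permutations_of_set ((P - T) \<union> Q) \<and> Y \<noteq> [] \<and> hd Y \<in> Q \<and> last Y \<in> Q. x ^ ldes Y))"
proof -
  have disj: "P \<inter> Q = {}" using PQ less_irrefl by blast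
  have "alt_sum x P Q = (\<Sum>l | l \<in> permutations_of_set (P \<union> Q) \<and> l \<noteq> [] \<and> hd l \<in> P.
      if last l \<in> Q then x ^ ldes l else 0)"
    unfolding alt_sum_def by (subst sum.inter_filter[symmetric]) (auto intro!: sum.cong)
  also have "\<dots> = (\<Sum>T\<in>Pow P - {{}}. \<Sum>S\<in>permutations_of_set T.
       \<Sum>Y | Y \<in> permutations_of_set ((P - T) \<union> Q) \<and> (Y = [] \<or> hd Y \<in> Q).
         if last (S @ Y) \<in> Q then x ^ ldes (S @ Y) else 0)"
    by (rule sum_permutations_prefix[OF disj fin])
  also have "\<dots> = (\<Sum>T\<in>Pow P - {{}}. \<Sum>S\<in>permutations_of_set T. x ^ ldes S *
       (\<Sum>Y | Y \<in> permutations_of_set ((P - T) \<union> Q) \<and> Y \<noteq> [] \<and> hd Y \<in> Q \<and> last Y \<in> Q. x ^ ldes Y))"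
  proof (intro sum.cong refl)
    fix T S assume T: "T \<in> Pow P - {{}}" and S: "S \<in> permutations_of_set T"
    have "(\<Sum>Y | Y \<in> permutations_of_set ((P - T) \<union> Q) \<and> (Y = [] \<or> hd Y \<in> Q).
        if last (S @ Y) \<in> Q then x ^ ldes (S @ Y) else 0) =
      (\<Sum>Y | Y \<in> permutations_of_set ((P - T) \<union> Q) \<and> (Y = [] \<or> hd Y \<in> Q).
        if Y \<noteq> [] \<and> last Y \<in> Q then x ^ ldes S * x ^ ldes Y else 0)"
    proof (intro sum.cong refl)
      fix Y assume "Y \<in> {Y. Y \<in> permutations_of_set ((P - T) \<union> Q) \<and> (Y = [] \<or> hd Y \<in> Q)}"
      then have Y: "set Y = (P - T) \<union> Q" "Y = [] \<or> hd Y \<in> Q"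
        by (auto simp: permutations_of_set_def)
      then have "Y \<noteq> []" using \<open>Q \<noteq> {}\<close> by auto
      moreover have "S \<noteq> []" "last S \<in> P"
        using S T last_in_set[of S] by (auto simp: permutations_of_set_def)
      moreover have "\<not> hd Y < last S"
        using Y(2) \<open>Y \<noteq> []\<close> \<open>last S \<in> P\<close> PQ by (meson less_asym)
      ultimately show "(if last (S @ Y) \<in> Q then x ^ ldes (S @ Y) else 0) =
        (if Y \<noteq> [] \<and> last Y \<in> Q then x ^ ldes S * x ^ ldes Y else 0)"
        by (simp add: ldes_append power_add)
    qed
    also have "\<dots> = (\<Sum>Y | Y \<in> permutations_of_set ((P - T) \<union> Q) \<and> Y \<noteq> [] \<and> hd Y \<in> Q \<and> last Y \<in> Q. x ^ ldes S * x ^ ldes Y)"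
      by (subst sum.inter_filter[symmetric]) (auto intro!: sum.cong)
    finally show "(\<Sum>Y | Y \<in> permutations_of_set ((P - T) \<union> Q) \<and> (Y = [] \<or> hd Y \<in> Q).
        if last (S @ Y) \<in> Q then x ^ ldes (S @ Y) else 0) = x ^ ldes S *
       (\<Sum>Y | Y \<in> permutations_of_set ((P - T) \<union> Q) \<and> Y \<noteq> [] \<and> hd Y \<in> Q \<and> last Y \<in> Q. x ^ ldes Y)"
      by (simp add: sum_distrib_left)
  qed
  finally show ?thesis by (simp add: stack_sum_empty sum_distrib_right)
qed

text \<open>Cut after the first run of large entries, with entry set \<open>U\<close>. Either the
  word ends there, which forces \<open>U = Q\<close> and \<open>P = {}\<close>, or a small entry
  follows: the cut is then a descent with factor \<open>x\<close>, and the remainder again starts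
  small and ends large.\<close>

lemma alt_sum_prefix_large:
  assumes fin: "finite P" "finite Q" and PQ: "\<forall>p\<in>P. \<forall>q\<in>Q. p < q" and "Q \<noteq> {}"
  shows "(\<Sum>Y | Y \<in> permutations_of_set (P \<union> Q) \<and> Y \<noteq> [] \<and> hd Y \<in> Q \<and> last Y \<in> Q. x ^ ldes Y) =
    (if P = {} then stack_sum x Q {} else 0) +
    x * (\<Sum>U\<in>Pow Q - {{}}. stack_sum x U {} * alt_sum x P (Q - U))"
proof -
  have disj: "Q \<inter> P = {}" using PQ less_irrefl by blast
  have "(\<Sum>Y | Y \<in> permutations_of_set (P \<union> Q) \<and> Y \<noteq> [] \<and> hd Y \<in> Q \<and> last Y \<in> Q. x ^ ldes Y) =
    (\<Sum>l | l \<in> permutations_of_set (Q \<union> P) \<and> l \<noteq> [] \<and> hd l \<in> Q. if last l \<in> Q then x ^ ldes l else 0)"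
    by (subst sum.inter_filter[symmetric]) (auto intro!: sum.cong simp: Un_commute)
  also have "\<dots> = (\<Sum>U\<in>Pow Q - {{}}. \<Sum>S\<in>permutations_of_set U.
       \<Sum>Y | Y \<in> permutations_of_set ((Q - U) \<union> P) \<and> (Y = [] \<or> hd Y \<in> P).
         if last (S @ Y) \<in> Q then x ^ ldes (S @ Y) else 0)"
    by (rule sum_permutations_prefix[OF disj fin(2,1)])
  also have "\<dots> = (\<Sum>U\<in>Pow Q - {{}}. \<Sum>S\<in>permutations_of_set U.
       x ^ ldes S * ((if U = Q \<and> P = {} then 1 else 0) + x * alt_sum x P (Q - U)))"
  proof (intro sum.cong refl)
    fix U S assume U: "U \<in> Pow Q - {{}}" and S: "S \<in> permutations_of_set U"
    have S': "S \<noteq> []" "last S \<in> Q"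
      using S U last_in_set[of S] by (auto simp: permutations_of_set_def)
    let ?Z = "(Q - U) \<union> P"
    let ?f = "\<lambda>Y. if last (S @ Y) \<in> Q then x ^ ldes (S @ Y) else 0"
    have "{Y. Y \<in> permutations_of_set ?Z \<and> (Y = [] \<or> hd Y \<in> P)} =
        {Y. Y \<in> permutations_of_set ?Z \<and> Y = []} \<union> {Y. Y \<in> permutations_of_set ?Z \<and> Y \<noteq> [] \<and> hd Y \<in> P}"
      by auto
    then have "(\<Sum>Y | Y \<in> permutations_of_set ?Z \<and> (Y = [] \<or> hd Y \<in> P). ?f Y) =
      (\<Sum>Y | Y \<in> permutations_of_set ?Z \<and> Y = []. ?f Y) +
      (\<Sum>Y | Y \<in> permutations_of_set ?Z \<and> Y \<noteq> [] \<and> hd Y \<in> P. ?f Y)"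
      by (simp only:) (rule sum.union_disjoint, auto)
    also have "{Y. Y \<in> permutations_of_set ?Z \<and> Y = []} = (if U = Q \<and> P = {} then {[]} else {})"
      using U by (auto simp: permutations_of_set_def)
    also have "(\<Sum>Y\<in>(if U = Q \<and> P = {} then {[]} else {}). ?f Y) = x ^ ldes S * (if U = Q \<and> P = {} then 1 else 0)"
      using S' by simp
    also have "(\<Sum>Y | Y \<in> permutations_of_set ?Z \<and> Y \<noteq> [] \<and> hd Y \<in> P. ?f Y) =
      (\<Sum>Y | Y \<in> permutations_of_set ?Z \<and> Y \<noteq> [] \<and> hd Y \<in> P. if last Y \<in> Q - U then x ^ ldes S * (x * x ^ ldes Y) else 0)"
    proof (intro sum.cong refl)
      fix Y assume "Y \<in> {Y. Y \<in> permutations_of_set ?Z \<and> Y \<noteq> [] \<and> hd Y \<in> P}"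
      then have Y: "set Y = ?Z" "Y \<noteq> []" "hd Y \<in> P" by (auto simp: permutations_of_set_def)
      have "hd Y < last S" using Y(3) S'(2) PQ by blast
      moreover have "last Y \<in> Q \<longleftrightarrow> last Y \<in> Q - U"
        using last_in_set[OF Y(2)] disj unfolding Y(1) by blast
      ultimately show "?f Y = (if last Y \<in> Q - U then x ^ ldes S * (x * x ^ ldes Y) else 0)"
        using Y(2) S' by (simp add: ldes_append power_add)
    qed
    also have "\<dots> = (\<Sum>Y | Y \<in> permutations_of_set (P \<union> (Q - U)) \<and> Y \<noteq> [] \<and> hd Y \<in> P \<and> last Y \<in> Q - U. x ^ ldes S * (x * x ^ ldes Y))"
      by (subst sum.inter_filter[symmetric]) (auto intro!: sum.cong simp: Un_commute)
    also have "\<dots> = x ^ ldes S * (x * alt_sum x P (Q - U))"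
      by (simp add: alt_sum_def sum_distrib_left)
    finally show "(\<Sum>Y | Y \<in> permutations_of_set ?Z \<and> (Y = [] \<or> hd Y \<in> P). ?f Y) =
      x ^ ldes S * ((if U = Q \<and> P = {} then 1 else 0) + x * alt_sum x P (Q - U))"
      by (simp only: distrib_left)
  qed
  also have "\<dots> = (\<Sum>U\<in>Pow Q - {{}}. (if U = Q then if P = {} then stack_sum x Q {} else 0 else 0) +
      x * (stack_sum x U {} * alt_sum x P (Q - U)))"
    by (intro sum.cong refl, subst sum_distrib_right[symmetric]) (auto simp: stack_sum_empty algebra_simps)
  also have "\<dots> = (if P = {} then stack_sum x Q {} else 0) +
    x * (\<Sum>U\<in>Pow Q - {{}}. stack_sum x U {} * alt_sum x P (Q - U))"
    using assms by (simp add: sum.distrib sum_distrib_left)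
  finally show ?thesis .
qed

lemma sum_Pow_card_nonempty:
  assumes "finite S"
  shows "(\<Sum>T\<in>Pow S - {{}}. f (card T)) = (\<Sum>i = 1..card S. of_nat (card S choose i) * (f i :: 'a::comm_ring_1))"
proof -
  have "(\<Sum>T\<in>Pow S. f (card T)) = f 0 + (\<Sum>T\<in>Pow S - {{}}. f (card T))"
    using assms by (subst sum.remove[of _ "{}"]) auto
  moreover have "{..card S} = insert 0 {1..card S}" by auto
  then have "(\<Sum>i\<le>card S. of_nat (card S choose i) * f i) = f 0 + (\<Sum>i = 1..card S. of_nat (card S choose i) * f i)"
    by simp
  ultimately show ?thesis using sum_Pow_card[OF assms, of f] by simp
qed

text \<open>\<open>p\<close> is the length of the first small run; \<open>p = m\<close> allows the
  word to finish with one large run. In the inner sum \<open>k - j\<close> is the length of the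
  first large run: it is nonempty, so \<open>j < k\<close>, and the remainder must still end in a
  large entry, so \<open>j \<ge> 1\<close>.\<close>

definition alt_rhs :: "'a::comm_ring_1 \<Rightarrow> nat \<Rightarrow> nat \<Rightarrow> 'a" where
  "alt_rhs x m k = (\<Sum>p = 1..m. of_nat (m choose p) * (stack_numb x 0 p *
     ((if p = m then stack_numb x 0 k else 0) +
      x * (\<Sum>j = 1..<k. of_nat (k choose j) * (stack_numb x 0 (k - j) * alt_numb x (m - p) j)))))"

lemma alt_sum_step:
  assumes fin: "finite P" "finite Q" and PQ: "\<forall>p\<in>P. \<forall>q\<in>Q. p < q" and "Q \<noteq> {}"
    and IH: "\<And>P' Q'. finite P' \<Longrightarrow> finite Q' \<Longrightarrow> \<forall>p\<in>P'. \<forall>q\<in>Q'. p < q \<Longrightarrow>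
      card P' + card Q' < card P + card Q \<Longrightarrow> alt_sum x P' Q' = alt_numb x (card P') (card Q')"
  shows "alt_sum x P Q = alt_rhs x (card P) (card Q)"
proof -
  define k where "k = card Q"
  have A: "stack_sum x T {} = stack_numb x 0 (card T)" if "finite T" for T
    using stack_sum_card[of T "{}" x] that by simp
  have alt0: "alt_numb x m 0 = 0" for m by (simp add: alt_numb_def alt_sum_empty_right)
  have inner: "(\<Sum>Y | Y \<in> permutations_of_set ((P - T) \<union> Q) \<and> Y \<noteq> [] \<and> hd Y \<in> Q \<and> last Y \<in> Q. x ^ ldes Y) =
      (if card T = card P then stack_numb x 0 k else 0) +
      x * (\<Sum>j = 1..<k. of_nat (k choose j) * (stack_numb x 0 (k - j) * alt_numb x (card P - card T) j))"
    if T: "T \<in> Pow P - {{}}" for T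
  proof -
    have fT: "finite T" and TP: "T \<subseteq> P" and Tpos: "card T > 0"
      using T fin finite_subset by (auto simp: card_gt_0_iff)
    have c: "card (P - T) = card P - card T" using fT TP by (simp add: card_Diff_subset)
    have le: "card T \<le> card P" using TP fin by (intro card_mono)
    have P0: "P - T = {} \<longleftrightarrow> card T = card P"
      using card_subset_eq[OF fin(1) TP] TP by auto
    have "(\<Sum>U\<in>Pow Q - {{}}. stack_sum x U {} * alt_sum x (P - T) (Q - U)) =
      (\<Sum>U\<in>Pow Q - {{}}. (\<lambda>i. stack_numb x 0 i * alt_numb x (card P - card T) (k - i)) (card U))"
    proof (intro sum.cong refl)
      fix U assume U: "U \<in> Pow Q - {{}}"
      then have fU: "finite U" using fin finite_subset by auto
      have cU: "card (Q - U) = k - card U" using U fU by (simp add: card_Diff_subset k_def)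
      have "alt_sum x (P - T) (Q - U) = alt_numb x (card (P - T)) (card (Q - U))"
        using fin PQ Tpos le by (intro IH) (auto simp: c cU k_def)
      then show "stack_sum x U {} * alt_sum x (P - T) (Q - U) =
        (\<lambda>i. stack_numb x 0 i * alt_numb x (card P - card T) (k - i)) (card U)"
        by (simp add: A[OF fU] c cU)
    qed
    also have "\<dots> = (\<Sum>i = 1..k. of_nat (k choose i) * (stack_numb x 0 i * alt_numb x (card P - card T) (k - i)))"
      using sum_Pow_card_nonempty[OF fin(2), of "\<lambda>i. stack_numb x 0 i * alt_numb x (card P - card T) (k - i)"]
      by (simp add: k_def)
    \<comment> \<open>A large run that uses up \<open>Q\<close> leaves no large entry to end the
      remainder, so the term \<open>i = k\<close> vanishes by \<open>alt0\<close>.\<close>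
    also have "\<dots> = (\<Sum>i = 1..<k. of_nat (k choose i) * (stack_numb x 0 i * alt_numb x (card P - card T) (k - i)))"
      by (rule sum.mono_neutral_right) (auto simp: alt0 not_less)
    also have "\<dots> = (\<Sum>j = 1..<k. of_nat (k choose j) * (stack_numb x 0 (k - j) * alt_numb x (card P - card T) j))"
      by (rule sum.reindex_bij_witness[where i = "\<lambda>i. k - i" and j = "\<lambda>i. k - i"])
        (auto simp: binomial_symmetric[symmetric])
    finally have eq: "(\<Sum>U\<in>Pow Q - {{}}. stack_sum x U {} * alt_sum x (P - T) (Q - U)) = \<dots>" .
    have "(\<Sum>Y | Y \<in> permutations_of_set ((P - T) \<union> Q) \<and> Y \<noteq> [] \<and> hd Y \<in> Q \<and> last Y \<in> Q. x ^ ldes Y) =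
      (if P - T = {} then stack_sum x Q {} else 0) +
      x * (\<Sum>U\<in>Pow Q - {{}}. stack_sum x U {} * alt_sum x (P - T) (Q - U))"
      using fin PQ \<open>Q \<noteq> {}\<close> by (intro alt_sum_prefix_large) auto
    then show ?thesis unfolding eq P0 A[OF fin(2)] by (simp add: k_def)
  qed
  have "alt_sum x P Q = (\<Sum>T\<in>Pow P - {{}}. (\<lambda>p. stack_numb x 0 p * ((if p = card P then stack_numb x 0 k else 0) +
      x * (\<Sum>j = 1..<k. of_nat (k choose j) * (stack_numb x 0 (k - j) * alt_numb x (card P - p) j)))) (card T))"
    unfolding alt_sum_prefix_small[OF fin PQ \<open>Q \<noteq> {}\<close>]
  proof (intro sum.cong refl)
    fix T assume T: "T \<in> Pow P - {{}}"
    then have "finite T" using fin finite_subset by auto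
    then show "stack_sum x T {} * (\<Sum>Y | Y \<in> permutations_of_set ((P - T) \<union> Q) \<and> Y \<noteq> [] \<and> hd Y \<in> Q \<and> last Y \<in> Q. x ^ ldes Y) =
      (\<lambda>p. stack_numb x 0 p * ((if p = card P then stack_numb x 0 k else 0) +
      x * (\<Sum>j = 1..<k. of_nat (k choose j) * (stack_numb x 0 (k - j) * alt_numb x (card P - p) j)))) (card T)"
      unfolding inner[OF T] by (simp add: A)
  qed
  then show ?thesis
    by (subst (asm) sum_Pow_card_nonempty[OF fin(1)]) (simp add: alt_rhs_def flip: k_def)
qed

text \<open>As for \<open>stack_sum_card\<close>, the given sets and the intervals obey the same
  recurrence. The case \<open>Q = {}\<close> is separate because \<open>alt_sum_step\<close> assumes
  \<open>Q\<close> nonempty; both sides are then zero.\<close>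

lemma alt_sum_card:
  assumes "finite P" "finite Q" "\<forall>p\<in>P. \<forall>q\<in>Q. p < q"
  shows "alt_sum x P Q = alt_numb x (card P) (card Q)"
  using assms
proof (induction "card P + card Q" arbitrary: P Q rule: less_induct)
  case less
  show ?case
  proof (cases "Q = {}")
    case True
    then show ?thesis by (simp add: alt_numb_def alt_sum_empty_right)
  next
    case False
    have step: "alt_sum x P' Q' = alt_rhs x (card P') (card Q')"
      if "finite P'" "finite Q'" "\<forall>p\<in>P'. \<forall>q\<in>Q'. p < q" "Q' \<noteq> {}" "card P' + card Q' = card P + card Q" for P' Q'
      using that less.hyps by (intro alt_sum_step) auto
    have "1 \<le> card Q" using False less.prems(2) by (simp add: Suc_le_eq card_gt_0_iff)
    then show ?thesis
      using less.prems False step[of P Q] step[of "{1..card P}" "{card P + 1..card P + card Q}"]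
      by (simp add: alt_numb_def)
  qed
qed

lemma alt_numb_rec:
  assumes "k \<ge> 1"
  shows "alt_numb x m k = alt_rhs x m k"
proof -
  have "alt_sum x {1..m} {m + 1..m + k} = alt_rhs x (card {1..m}) (card {m + 1..m + k})"
    using assms by (intro alt_sum_step) (auto intro: alt_sum_card)
  then show ?thesis by (simp add: alt_numb_def)
qed

section \<open>Values of \<open>E_poly\<close> and \<open>N_poly\<close> as sums over words\<close>

lemma finite_sym_group: "finite (sym_group n)"
  by (simp add: sym_group_def finite_permutations)

lemma poly_E_poly:
  assumes "k \<ge> 1"
  shows "poly (E_poly m k) x = alt_numb x m k"
proof -
  let ?n = "m + k"
  have un: "{1..m} \<union> {m + 1..?n} = {1..?n}" by auto
  have "(\<Sum>w | w \<in> sym_group ?n \<and> w 1 \<le> m \<and> w ?n \<ge> m + 1. x ^ des ?n w) =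
    (\<Sum>l | l \<in> permutations_of_set {1..?n} \<and> l \<noteq> [] \<and> hd l \<in> {1..m} \<and> last l \<in> {m + 1..?n}. x ^ ldes l)"
  proof -
    have iff: "one_line ?n w \<noteq> [] \<and> hd (one_line ?n w) \<in> {1..m} \<and> last (one_line ?n w) \<in> {m + 1..?n} \<longleftrightarrow>
      w 1 \<le> m \<and> w ?n \<ge> m + 1" if "w \<in> sym_group ?n" for w
    proof -
      have "w i \<in> {1..?n}" if "i \<in> {1..?n}" for i
        using \<open>w \<in> sym_group ?n\<close> that permutes_in_image[of w "{1..?n}" i] by (simp add: sym_group_def)
      from this[of 1] this[of ?n] show ?thesis
        using assms by (auto simp: one_line_def hd_map last_map simp del: upt_Suc)
    qed
    have "(\<Sum>l | l \<in> permutations_of_set {1..?n} \<and> l \<noteq> [] \<and> hd l \<in> {1..m} \<and> last l \<in> {m + 1..?n}. x ^ ldes l) =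
      (\<Sum>l\<in>permutations_of_set {1..?n}. if l \<noteq> [] \<and> hd l \<in> {1..m} \<and> last l \<in> {m + 1..?n} then x ^ ldes l else 0)"
      by (simp add: sum.inter_filter)
    also have "\<dots> = (\<Sum>w\<in>sym_group ?n. if w 1 \<le> m \<and> w ?n \<ge> m + 1 then x ^ des ?n w else 0)"
      by (subst sum.reindex_bij_betw[OF bij_betw_one_line, symmetric])
        (intro sum.cong refl, simp only: iff ldes_one_line)
    also have "\<dots> = (\<Sum>w | w \<in> sym_group ?n \<and> w 1 \<le> m \<and> w ?n \<ge> m + 1. x ^ des ?n w)"
      by (simp add: sum.inter_filter finite_sym_group)
    finally show ?thesis by simp
  qed
  then show ?thesis
    by (simp only: E_poly_def alt_numb_def alt_sum_def un poly_sum poly_monom mult_1)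
qed


text \<open>The stack output is the one-line word of \<open>stack_sort\<close>, so the suffix
  condition says exactly that the positions \<open>k + 1\<close> to \<open>k + n\<close> are fixed;
  all later positions are fixed anyway.\<close>

lemma poly_N_poly: "poly (N_poly n k) x = stack_numb x n k"
proof -
  let ?m = "n + k"
  have un: "{1..k} \<union> {k + 1..k + n} = {1..?m}" by auto
  have up: "sorted_list_of_set {k + 1..k + n} = [Suc k..<Suc ?m]"
    using sorted_list_of_set_range[of "Suc k" "Suc ?m"]
    by (simp add: atLeastLessThanSuc_atLeastAtMost add.commute del: upt_Suc)
  have iff: "suffix (sorted_list_of_set {k + 1..k + n}) (stack_run (one_line ?m w) []) \<longleftrightarrow>
      stack_sort ?m w \<in> sym_fix n k" if w: "w \<in> sym_group ?m" for w
  proof -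
    define v where "v = stack_sort ?m w"
    have v: "v \<in> sym_group ?m" unfolding v_def by (rule stack_sort_in_sym_group[OF w])
    have "[1..<Suc ?m] = [1..<Suc k] @ [Suc k..<Suc ?m]"
      using upt_add_eq_append[of 1 "Suc k" n] by (simp add: add.commute del: upt_Suc)
    then have run: "stack_run (one_line ?m w) [] = map v [1..<Suc k] @ map v [Suc k..<Suc ?m]"
      unfolding one_line_stack_sort[symmetric] v_def[symmetric] by (simp add: one_line_def del: upt_Suc)
    have "suffix (sorted_list_of_set {k + 1..k + n}) (stack_run (one_line ?m w) []) \<longleftrightarrow>
      [Suc k..<Suc ?m] = map v [Suc k..<Suc ?m]"
      unfolding run up using suffix_append_same_length[of "[Suc k..<Suc ?m]" "map v [Suc k..<Suc ?m]" "[]"]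
      by (simp del: upt_Suc)
    also have "\<dots> \<longleftrightarrow> (\<forall>i\<in>{k<..?m}. v i = i)"
      using map_eq_conv[of id "[Suc k..<Suc ?m]" v] by (auto simp del: upt_Suc)
    also have "\<dots> \<longleftrightarrow> (\<forall>i>k. v i = i)"
    proof -
      have "v i = i" if "i > ?m" for i
        using v that by (auto simp: sym_group_def intro: permutes_not_in)
      then show ?thesis by (auto simp: not_le[symmetric])
    qed
    finally show ?thesis using v by (simp add: sym_fix_def v_def)
  qed
  have "stack_numb x n k = (\<Sum>l\<in>permutations_of_set {1..?m}.
      if suffix (sorted_list_of_set {k + 1..k + n}) (stack_run l []) then x ^ ldes l else 0)"
    by (simp only: stack_numb_def stack_sum_def un) (simp add: sum.inter_filter)
  also have "\<dots> = (\<Sum>w\<in>sym_group ?m. if stack_sort ?m w \<in> sym_fix n k then x ^ des ?m w else 0)"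
    by (subst sum.reindex_bij_betw[OF bij_betw_one_line, symmetric])
      (intro sum.cong refl, simp only: iff ldes_one_line)
  also have "\<dots> = poly (N_poly n k) x"
    by (simp only: N_poly_def poly_sum poly_monom mult_1) (simp only: sum.inter_filter[OF finite_sym_group])
  finally show ?thesis by simp
qed

section \<open>The exponential formula for permutations\<close>

definition cyclic_perms :: "'a set \<Rightarrow> ('a \<Rightarrow> 'a) set" where
  "cyclic_perms C = {c. c permutes C \<and> cyclic_on c C}"

text \<open>\<open>c\<close> moves only points of \<open>C\<close> and \<open>w\<close> only points
  of \<open>T\<close>, so on each of the two sets the composition acts as one factor.\<close>

lemma orbit_comp_disjoint:
  assumes "finite C" "finite T" "C \<inter> T = {}" "c \<in> cyclic_perms C" "w permutes T"
  shows "x \<in> C \<Longrightarrow> orbit (c \<circ> w) x = C"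
    and "x \<in> T \<Longrightarrow> orbit (c \<circ> w) x = orbit w x"
proof -
  have c: "c permutes C" "cyclic_on c C" using assms(4) by (auto simp: cyclic_perms_def)
  have "cyclic_on (c \<circ> w) C"
    using assms(3) by (intro permutes_comp_preserves_cyclic1[OF assms(5) c(2)]) auto
  then show "x \<in> C \<Longrightarrow> orbit (c \<circ> w) x = C" by (rule orbit_cyclic_eq3)
  assume x: "x \<in> T"
  show "orbit (c \<circ> w) x = orbit w x"
  proof (rule orbit_cong0[OF x])
    show "(c \<circ> w) y = w y" if "y \<in> T" for y
      using that assms(3,5) c(1) by (auto simp: permutes_in_image intro!: permutes_not_in[of c])
    then show "c \<circ> w \<in> T \<rightarrow> T" using assms(5) by (auto simp: permutes_in_image)
  qed
qed

text \<open>Each permutation of \<open>S\<close> is uniquely \<open>c \<circ> w\<close> with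
  \<open>c\<close> a full cycle on the orbit \<open>C\<close> of \<open>s\<close> and
  \<open>w\<close> a permutation of the rest. The summand may depend on the set of orbits only,
  which is enough for cycle types.\<close>

lemma sum_permutes_by_cycle:
  assumes "finite S" "s \<in> S"
  shows "(\<Sum>w | w permutes S. f (orbit w ` S)) =
    (\<Sum>C | C \<subseteq> S \<and> s \<in> C. \<Sum>c\<in>cyclic_perms C. \<Sum>w | w permutes (S - C). f (insert C (orbit w ` (S - C))))"
proof -
  let ?A = "SIGMA C:{C. C \<subseteq> S \<and> s \<in> C}. cyclic_perms C \<times> {w. w permutes (S - C)}"
  have "(\<Sum>w | w permutes S. f (orbit w ` S)) = (\<Sum>(C, c, w)\<in>?A. f (insert C (orbit w ` (S - C))))"
  proof (rule sum.reindex_bij_witness[where i = "\<lambda>(C, c, w). c \<circ> w" and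
      j = "\<lambda>w. (orbit w s, perm_restrict w (orbit w s), perm_restrict w (S - orbit w s))"])
    fix w assume "w \<in> {w. w permutes S}"
    then have w: "w permutes S" by simp
    define C where "C = orbit w s"
    have CS: "C \<subseteq> S" unfolding C_def using w assms(2) by (rule permutes_orbit_subset)
    have cyc: "cyclic_on w C" unfolding C_def using w assms(1) by (rule cyclic_on_orbit)
    have sC: "s \<in> C" unfolding C_def
      using w assms(1) by (intro permutation_self_in_orbit) (auto simp: permutation_permutes)
    have r1: "perm_restrict w (S - C) permutes (S - C)"
      using w cyc by (rule perm_restrict_diff_cyclic)
    \<comment> \<open>\<open>w\<close> maps the finite set \<open>C\<close> into itself, so
      injectivity already makes the restriction a bijection of \<open>C\<close>.\<close>
    have "perm_restrict w (S - (S - C)) permutes (S - (S - C))"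
    proof (rule bij_imp_permutes)
      have eq: "S - (S - C) = C" using CS by auto
      have "inj_on (perm_restrict w C) C"
        using w by (auto simp: inj_on_def perm_restrict_def permutes_def)
      moreover have "perm_restrict w C ` C \<subseteq> C"
        using cyclic_on_inI[OF cyc] by (auto simp: perm_restrict_def)
      moreover have "finite C" using CS assms(1) finite_subset by blast
      ultimately show "bij_betw (perm_restrict w (S - (S - C))) (S - (S - C)) (S - (S - C))"
        by (simp add: bij_betw_def eq endo_inj_surj)
    qed (auto simp: perm_restrict_def)
    then have r2: "perm_restrict w C permutes C" using CS by (simp add: double_diff)
    have cp: "perm_restrict w C \<in> cyclic_perms C"
      using r2 cyc by (simp add: cyclic_perms_def cyclic_on_perm_restrict)
    have comp: "perm_restrict w C \<circ> perm_restrict w (S - C) = w"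
    proof -
      have "perm_restrict w C \<circ> perm_restrict w (S - C) = perm_restrict w (C \<union> (S - C))"
        by (rule perm_restrict_union[OF r2 r1]) auto
      also have "C \<union> (S - C) = S" using CS by auto
      finally show ?thesis by (simp only: perm_restrict_id[OF w])
    qed
    show "(case (orbit w s, perm_restrict w (orbit w s), perm_restrict w (S - orbit w s)) of
      (C, c, w) \<Rightarrow> c \<circ> w) = w"
      using comp by (simp add: C_def)
    show "(orbit w s, perm_restrict w (orbit w s), perm_restrict w (S - orbit w s)) \<in> ?A"
      using CS sC cp r1 by (simp add: C_def)
    have "orbit w ` S = orbit w ` C \<union> orbit w ` (S - C)" using CS by auto
    also have "orbit w ` C = {C}" using orbit_cyclic_eq3[OF cyc] sC by auto
    also have "orbit w ` (S - C) = orbit (perm_restrict w (S - C)) ` (S - C)"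
    proof (rule image_cong[OF refl])
      fix x assume x: "x \<in> S - C"
      have "orbit (perm_restrict w C \<circ> perm_restrict w (S - C)) x = orbit (perm_restrict w (S - C)) x"
        using assms(1) CS cp r1 x by (intro orbit_comp_disjoint(2)[of C "S - C"]) (auto intro: finite_subset)
      then show "orbit w x = orbit (perm_restrict w (S - C)) x" by (simp add: comp)
    qed
    finally show "(case (orbit w s, perm_restrict w (orbit w s), perm_restrict w (S - orbit w s)) of
      (C, c, w) \<Rightarrow> f (insert C (orbit w ` (S - C)))) = f (orbit w ` S)"
      by (simp add: C_def)
  next
    fix p assume p: "p \<in> ?A"
    obtain C c w where [simp]: "p = (C, c, w)" by (cases p)
    have C: "C \<subseteq> S" "s \<in> C" "c \<in> cyclic_perms C" "w permutes (S - C)" using p by auto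
    have c: "c permutes C" using C(3) by (simp add: cyclic_perms_def)
    have fin: "finite C" "finite (S - C)" using assms(1) C(1) finite_subset by auto
    have orb: "orbit (c \<circ> w) s = C" using fin C by (intro orbit_comp_disjoint(1)[of C "S - C"]) auto
    have "perm_restrict (c \<circ> w) C = c" "perm_restrict (c \<circ> w) (S - C) = w"
    proof (auto simp: fun_eq_iff perm_restrict_def)
      show "x \<in> C \<Longrightarrow> c (w x) = c x" for x using C(4) by (subst permutes_not_in[of w]) auto
      show "x \<notin> C \<Longrightarrow> x = c x" for x using c by (simp add: permutes_not_in)
      show "x \<in> S \<Longrightarrow> x \<notin> C \<Longrightarrow> c (w x) = w x" for x
        using permutes_in_image[OF C(4), of x] by (intro permutes_not_in[OF c]) auto
      show "x \<notin> S \<Longrightarrow> x = w x" "x \<in> C \<Longrightarrow> x = w x" for x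
        using C(4) by (simp_all add: permutes_not_in)
    qed
    then show "(\<lambda>w. (orbit w s, perm_restrict w (orbit w s), perm_restrict w (S - orbit w s)))
      (case p of (C, c, w) \<Rightarrow> c \<circ> w) = p"
      by (simp add: orb)
    have "c permutes S" "w permutes S"
      using c C(1,4) by (auto intro: permutes_subset)
    then show "(case p of (C, c, w) \<Rightarrow> c \<circ> w) \<in> {w. w permutes S}"
      by (simp add: permutes_compose)
  qed
  also have "\<dots> = (\<Sum>C | C \<subseteq> S \<and> s \<in> C. \<Sum>(c, w)\<in>cyclic_perms C \<times> {w. w permutes (S - C)}.
      f (insert C (orbit w ` (S - C))))"
  proof (rule sum.Sigma[symmetric])
    have "finite (cyclic_perms C)" if "C \<subseteq> S" for C
      using finite_permutations[OF finite_subset[OF that assms(1)]]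
      by (rule rev_finite_subset) (auto simp: cyclic_perms_def)
    then show "\<forall>C\<in>{C. C \<subseteq> S \<and> s \<in> C}. finite (cyclic_perms C \<times> {w. w permutes (S - C)})"
      using assms(1) by (auto intro: finite_permutations)
  qed (use assms in auto)
  finally show ?thesis by (simp add: sum.cartesian_product)
qed

lemma sum_subsets_containing:
  assumes "finite S" "s \<in> S"
  shows "(\<Sum>C | C \<subseteq> S \<and> s \<in> C. f (card C)) =
    (\<Sum>i<card S. of_nat ((card S - 1) choose i) * f (Suc i))"
proof -
  have "(\<Sum>C | C \<subseteq> S \<and> s \<in> C. f (card C)) = (\<Sum>T\<in>Pow (S - {s}). f (Suc (card T)))"
  proof (rule sum.reindex_bij_witness[where i = "insert s" and j = "\<lambda>C. C - {s}"])
    fix C assume "C \<in> {C. C \<subseteq> S \<and> s \<in> C}"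
    then have "Suc (card (C - {s})) = card C"
      using assms(1) by (metis (mono_tags) card_Suc_Diff1 finite_subset mem_Collect_eq)
    then show "f (Suc (card (C - {s}))) = f (card C)" by simp
  qed (use assms in auto)
  also have "\<dots> = (\<Sum>i\<le>card S - 1. of_nat ((card S - 1) choose i) * f (Suc i))"
    using assms by (subst sum_Pow_card) auto
  also have "{..card S - 1} = {..<card S}"
    using assms card_gt_0_iff[of S] by auto
  finally show ?thesis .
qed

text \<open>
  Counting all permutations of \<open>C\<close> by the cycle through a fixed element determines the number of full cycles.
\<close>

lemma card_cyclic_perms:
  "finite C \<Longrightarrow> C \<noteq> {} \<Longrightarrow> card (cyclic_perms C) = fact (card C - 1)"
proof (induction "card C" arbitrary: C rule: less_induct)
  case less
  define m where "m = card C - 1"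
  have m: "card C = Suc m" using less.prems by (simp add: m_def card_gt_0_iff)
  obtain s where s: "s \<in> C" using less.prems by auto
  have split: "{T. T \<subseteq> C \<and> s \<in> T} = insert C {T. T \<subset> C \<and> s \<in> T}" using s by auto
  have "fact (Suc m) = (\<Sum>w | w permutes C. 1::nat)"
    using card_permutations[OF m less.prems(1)] by simp
  also have "\<dots> = (\<Sum>T | T \<subseteq> C \<and> s \<in> T. card (cyclic_perms T) * fact (card C - card T))"
    unfolding sum_permutes_by_cycle[OF less.prems(1) s, of "\<lambda>_. 1"]
    using less.prems(1) s
    by (intro sum.cong refl) (auto simp: card_permutations card_Diff_subset finite_subset)
  also have "\<dots> = card (cyclic_perms C) + (\<Sum>T | T \<subset> C \<and> s \<in> T. card (cyclic_perms T) * fact (card C - card T))"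
    using less.prems(1) by (subst split, subst sum.insert) (auto intro: finite_subset[OF _ finite_Collect_subsets])
  also have "(\<Sum>T | T \<subset> C \<and> s \<in> T. card (cyclic_perms T) * fact (card C - card T)) =
      (\<Sum>T | T \<subset> C \<and> s \<in> T. fact (card T - 1) * fact (card C - card T))"
  proof (intro sum.cong refl)
    fix T assume "T \<in> {T. T \<subset> C \<and> s \<in> T}"
    then have "card (cyclic_perms T) = fact (card T - 1)"
      using less.prems(1) by (intro less.hyps psubset_card_mono) (auto intro: finite_subset)
    then show "card (cyclic_perms T) * fact (card C - card T) = fact (card T - 1) * fact (card C - card T)"
      by simp
  qed
  \<comment> \<open>The induction hypothesis covers the proper subsets. Adding \<open>m!\<close>,
    the value predicted for \<open>T = C\<close>, completes the sum, which is then
    \<open>m + 1\<close> copies of \<open>m!\<close>.\<close>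
  also have "fact m + \<dots> = (\<Sum>T | T \<subseteq> C \<and> s \<in> T. fact (card T - 1) * fact (card C - card T))"
    using less.prems(1) m
    by (subst split, subst sum.insert) (auto intro: finite_subset[OF _ finite_Collect_subsets])
  then have "(\<Sum>T | T \<subset> C \<and> s \<in> T. fact (card T - 1) * fact (card C - card T)) =
      (\<Sum>T | T \<subseteq> C \<and> s \<in> T. fact (card T - 1) * fact (card C - card T)) - (fact m :: nat)"
    by simp
  also have "(\<Sum>T | T \<subseteq> C \<and> s \<in> T. fact (card T - 1) * fact (card C - card T)) = 
    (\<Sum>i<Suc m. (m choose i) * (fact i * fact (m - i)) :: nat)"
    using sum_subsets_containing[OF less.prems(1) s, of "\<lambda>i. fact (i - 1) * fact (card C - i) :: nat"]
    by (simp add: m)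
  also have "\<dots> = (\<Sum>i<Suc m. fact m)"
    by (intro sum.cong refl) (metis binomial_fact_lemma lessThan_Suc_atMost atMost_iff mult.commute)
  finally show ?case by (simp add: m)
qed



text \<open>\<open>c\<close> weights a cycle by its length, \<open>g\<close> a permutation by its
  number of cycles. The theorem needs \<open>c n = B_n(x)\<close> and
  \<open>g l = E_{l,k}(x)\<close>; \<open>g\<close> is kept variable because removing a cycle shifts
  it.\<close>

definition cycle_sum :: "(nat \<Rightarrow> 'a::field_char_0) \<Rightarrow> (nat \<Rightarrow> 'a) \<Rightarrow> 'b set \<Rightarrow> 'a" where
  "cycle_sum c g S = (\<Sum>w | w permutes S. (\<Prod>C\<in>orbit w ` S. c (card C)) * g (card (orbit w ` S)))"

text \<open>Remove the cycle through \<open>s\<close>: on a given set \<open>C\<close> there are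
  \<open>(card C - 1)!\<close> choices for it, it contributes \<open>c (card C)\<close>, and it
  raises the number of cycles by one.\<close>

lemma cycle_sum_rec:
  assumes "finite S" "s \<in> S"
  shows "cycle_sum c g S =
    (\<Sum>C | C \<subseteq> S \<and> s \<in> C. fact (card C - 1) * c (card C) * cycle_sum c (\<lambda>l. g (Suc l)) (S - C))"
proof -
  have "cycle_sum c g S = (\<Sum>C | C \<subseteq> S \<and> s \<in> C. \<Sum>_\<in>cyclic_perms C. \<Sum>w | w permutes (S - C).
      (\<Prod>X\<in>insert C (orbit w ` (S - C)). c (card X)) * g (card (insert C (orbit w ` (S - C)))))"
    unfolding cycle_sum_def
    by (rule sum_permutes_by_cycle[OF assms, of "\<lambda>A. (\<Prod>X\<in>A. c (card X)) * g (card A)"])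
  also have "\<dots> = (\<Sum>C | C \<subseteq> S \<and> s \<in> C. fact (card C - 1) * c (card C) * cycle_sum c (\<lambda>l. g (Suc l)) (S - C))"
  proof (intro sum.cong refl)
    fix C assume C: "C \<in> {C. C \<subseteq> S \<and> s \<in> C}"
    then have fin: "finite C" "C \<noteq> {}" using assms(1) finite_subset by auto
    have "(\<Prod>X\<in>insert C (orbit w ` (S - C)). c (card X)) * g (card (insert C (orbit w ` (S - C)))) =
      c (card C) * ((\<Prod>X\<in>orbit w ` (S - C). c (card X)) * g (Suc (card (orbit w ` (S - C)))))"
      if w: "w permutes (S - C)" for w
    proof -
      have "C \<notin> orbit w ` (S - C)"
        using C permutes_orbit_subset[OF w] by blast
      then show ?thesis using assms(1) by simp
    qed
    then have "(\<Sum>_\<in>cyclic_perms C. \<Sum>w | w permutes (S - C).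
      (\<Prod>X\<in>insert C (orbit w ` (S - C)). c (card X)) * g (card (insert C (orbit w ` (S - C))))) =
      (\<Sum>_\<in>cyclic_perms C. c (card C) * cycle_sum c (\<lambda>l. g (Suc l)) (S - C))"
      by (simp add: cycle_sum_def sum_distrib_left)
    then show "(\<Sum>_\<in>cyclic_perms C. \<Sum>w | w permutes (S - C).
      (\<Prod>X\<in>insert C (orbit w ` (S - C)). c (card X)) * g (card (insert C (orbit w ` (S - C))))) =
      fact (card C - 1) * c (card C) * cycle_sum c (\<lambda>l. g (Suc l)) (S - C)"
      by (simp add: card_cyclic_perms[OF fin] mult.assoc)
  qed
  finally show ?thesis .
qed

text \<open>The exponential formula. Shifting \<open>g\<close> differentiates its exponential
  generating function \<open>G\<close>, so the recurrence for the cycle through a fixed element is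
  one coefficient of the chain rule
  \<open>(G oo \<beta>)' = \<beta>' * (G' oo \<beta>)\<close>.\<close>

lemma cycle_sum_fps:
  fixes c g :: "nat \<Rightarrow> 'a::field_char_0"
  assumes "finite S"
  shows "cycle_sum c g S =
    fact (card S) * (Abs_fps (\<lambda>l. g l / fact l) oo Abs_fps (\<lambda>n. if n = 0 then 0 else c n / of_nat n)) $ card S"
  using assms
proof (induction "card S" arbitrary: S g rule: less_induct)
  case less
  define \<beta> where "\<beta> = Abs_fps (\<lambda>n. if n = 0 then 0 else c n / of_nat n)"
  define G where "G = (\<lambda>g. Abs_fps (\<lambda>l. g l / fact l :: 'a))"
  show ?case
  proof (cases "S = {}")
    case True
    then show ?thesis by (simp add: cycle_sum_def)
  next
    case False
    then obtain s where s: "s \<in> S" by auto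
    define n where "n = card S - 1"
    have n: "card S = Suc n" using False less.prems by (simp add: n_def card_gt_0_iff)
    have G': "fps_deriv (G g) = G (\<lambda>l. g (Suc l))"
      by (rule fps_ext) (simp add: G_def field_simps del: of_nat_Suc)
    have IH: "cycle_sum c (\<lambda>l. g (Suc l)) (S - C) = fact (Suc n - card C) * (fps_deriv (G g) oo \<beta>) $ (Suc n - card C)"
      if "C \<subseteq> S" "s \<in> C" for C
    proof -
      have "card (S - C) < card S" using that s less.prems by (intro psubset_card_mono) auto
      moreover have "card (S - C) = Suc n - card C"
        using that less.prems n by (simp add: card_Diff_subset finite_subset)
      ultimately show ?thesis
        unfolding G' using less.hyps[of "S - C" "\<lambda>l. g (Suc l)"] less.prems by (simp add: G_def \<beta>_def)
    qed
    have "cycle_sum c g S = (\<Sum>C | C \<subseteq> S \<and> s \<in> C. fact (card C - 1) * c (card C) *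
        (fact (Suc n - card C) * (fps_deriv (G g) oo \<beta>) $ (Suc n - card C)))"
      unfolding cycle_sum_rec[OF less.prems s] using IH by (intro sum.cong refl) auto
    also have "\<dots> = (\<Sum>i\<le>n. of_nat (n choose i) * (fact i * c (Suc i) *
        (fact (n - i) * (fps_deriv (G g) oo \<beta>) $ (n - i))))"
      by (subst sum_subsets_containing[OF less.prems s, of
          "\<lambda>m. fact (m - 1) * c m * (fact (Suc n - m) * (fps_deriv (G g) oo \<beta>) $ (Suc n - m))"])
        (simp add: n lessThan_Suc_atMost)
    also have "\<dots> = (\<Sum>i\<le>n. fact n * (fps_deriv \<beta> $ i * (fps_deriv (G g) oo \<beta>) $ (n - i)))"
    proof (intro sum.cong refl)
      fix i assume "i \<in> {..n}"
      then have "of_nat (fact i * fact (n - i) * (n choose i)) = (of_nat (fact n) :: 'a)"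
        by (subst binomial_fact_lemma) auto
      then have "fact n = (fact i * fact (n - i) * of_nat (n choose i) :: 'a)" by simp
      then show "of_nat (n choose i) * (fact i * c (Suc i) * (fact (n - i) * (fps_deriv (G g) oo \<beta>) $ (n - i))) =
        fact n * (fps_deriv \<beta> $ i * (fps_deriv (G g) oo \<beta>) $ (n - i))"
        by (simp add: \<beta>_def algebra_simps del: of_nat_Suc)
    qed
    also have "\<dots> = fact n * (fps_deriv \<beta> * (fps_deriv (G g) oo \<beta>)) $ n"
      by (simp add: fps_mult_nth sum_distrib_left atMost_atLeast0)
    also have "fps_deriv \<beta> * (fps_deriv (G g) oo \<beta>) = fps_deriv (G g oo \<beta>)"
      by (simp add: fps_compose_deriv \<beta>_def mult.commute)
    also have "fact n * \<dots> $ n = fact (Suc n) * (G g oo \<beta>) $ Suc n"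
      by (simp add: algebra_simps)
    finally show ?thesis by (simp add: n G_def \<beta>_def)
  qed
qed

section \<open>Generating functions\<close>


lemma coeff_narayana_B: "coeff (narayana_B (Suc n)) k = of_nat ((n choose k) ^ 2)"
proof -
  have "coeff (narayana_B (Suc n)) k = (\<Sum>i = 0..n. if i = k then of_nat ((n choose i) ^ 2) else 0)"
    by (simp add: narayana_B_def coeff_sum)
  also have "\<dots> = of_nat ((n choose k) ^ 2)"
    by (cases "k \<le> n") (auto simp: binomial_eq_0)
  finally show ?thesis .
qed

text \<open>Absorption with a rational difference in place of truncated subtraction; for
  \<open>j > n\<close> both binomial coefficients vanish.\<close>

lemma binomial_absorb_rat: "rat_of_nat (n choose Suc j) * (of_nat j + 1) = of_nat (n choose j) * (of_nat n - of_nat j)"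
proof (cases "j \<le> n")
  case True
  have "Suc j * (n choose Suc j) = (n choose j) * (n - j)"
    by (metis binomial_absorb_comp binomial_absorption mult.commute)
  then have "rat_of_nat (Suc j * (n choose Suc j)) = rat_of_nat ((n choose j) * (n - j))" by simp
  then show ?thesis using True by (simp add: algebra_simps)
qed (simp add: binomial_eq_0)

text \<open>With the Legendre polynomials \<open>P_n\<close> one has
  \<open>B_{n+1}(x) = (1 - x)^n P_n((1 + x) / (1 - x))\<close>, and this is Bonnet's recurrence for
  them; \<open>[:1, -2, 1:]\<close> is \<open>(1 - x)^2\<close>. It is verified coefficient by
  coefficient.\<close>

lemma narayana_B_rec:
  "smult (of_nat (n + 2)) (narayana_B (n + 3)) =
    smult (of_nat (2 * n + 3)) ([:1, 1:] * narayana_B (n + 2)) - smult (of_nat (n + 1)) ([:1, -2, 1:] * narayana_B (n + 1))"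
proof (rule poly_eqI)
  fix k :: nat
  have B: "coeff (narayana_B (n + 3)) k = of_nat ((Suc (Suc n) choose k) ^ 2)"
    "coeff (narayana_B (n + 2)) k = of_nat ((Suc n choose k) ^ 2)"
    "coeff (narayana_B (n + 1)) k = of_nat ((n choose k) ^ 2)" for k
    using coeff_narayana_B[of "Suc (Suc n)" k] coeff_narayana_B[of "Suc n" k] coeff_narayana_B[of n k]
    by (simp_all add: numeral_3_eq_3)
  consider "k = 0" | "k = 1" | j where "k = Suc (Suc j)" by (metis One_nat_def not0_implies_Suc)
  then show "coeff (smult (of_nat (n + 2)) (narayana_B (n + 3))) k =
    coeff (smult (of_nat (2 * n + 3)) ([:1, 1:] * narayana_B (n + 2)) - smult (of_nat (n + 1)) ([:1, -2, 1:] * narayana_B (n + 1))) k"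
  proof cases
    case 1
    then show ?thesis by (simp only: coeff_diff coeff_smult coeff_mult_0 B) simp
  next
    case 2
    then show ?thesis by (simp add: coeff_pCons B coeff_narayana_B power2_eq_square algebra_simps)
  next
    case (3 j)
    \<comment> \<open>Both sides are quadratic forms in three neighbouring binomial coefficients;
      \<open>s\<close> and \<open>t\<close> express \<open>n\<close> and the ratios between
      neighbours.\<close>
    define p q r where "p = rat_of_nat (n choose j)" and "q = rat_of_nat (n choose Suc j)"
      and "r = rat_of_nat (n choose Suc (Suc j))"
    define s t where "s = rat_of_nat j + 1" and "t = rat_of_nat n - rat_of_nat j"
    have qs: "q * s = p * t" using binomial_absorb_rat[of n j] by (simp add: p_def q_def s_def t_def)
    have rs: "r * (s + 1) = q * (t - 1)"
      using binomial_absorb_rat[of n "Suc j"] by (simp add: q_def r_def s_def t_def algebra_simps)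
    have n: "rat_of_nat n = s + t - 1" by (simp add: s_def t_def)
    have spos: "s > 0" by (simp add: s_def)
    \<comment> \<open>The two sides of the coefficient identity differ by twice this form. It
      vanishes once \<open>p\<close> and \<open>r\<close> are expressed through \<open>q\<close>;
      division by \<open>t\<close> fails only for \<open>j = n\<close>, where
      \<open>q = r = 0\<close>.\<close>
    have K: "- (s + t - 1) * q\<^sup>2 + p * q + q * r + (s + t + 1) * p * r = 0"
    proof (cases "t = 0")
      case True
      then have "q = 0" using qs spos by auto
      then have "r = 0" using rs spos by auto
      then show ?thesis using \<open>q = 0\<close> by simp
    next
      case False
      have p: "p = q * s / t" using qs False by (simp add: field_simps)
      have r: "r = q * (t - 1) / (s + 1)" using rs spos by (simp add: field_simps)
      have "s + 1 \<noteq> 0" using spos by linarith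
      then show ?thesis using False unfolding p r
        by (simp add: divide_simps) (simp add: algebra_simps power2_eq_square)
    qed
    have "(s + t + 1) * (p + 2 * q + r)\<^sup>2 =
      (2 * (s + t - 1) + 3) * ((q + r)\<^sup>2 + (p + q)\<^sup>2) - (s + t) * (r\<^sup>2 - 2 * q\<^sup>2 + p\<^sup>2)
      + 2 * (- (s + t - 1) * q\<^sup>2 + p * q + q * r + (s + t + 1) * p * r)"
      by (simp add: algebra_simps power2_eq_square)
    then have main: "(rat_of_nat n + 2) * (p + 2 * q + r)\<^sup>2 =
      (2 * rat_of_nat n + 3) * ((q + r)\<^sup>2 + (p + q)\<^sup>2) - (rat_of_nat n + 1) * (r\<^sup>2 - 2 * q\<^sup>2 + p\<^sup>2)"
      unfolding K n by (simp add: algebra_simps)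
    have c1: "rat_of_nat (Suc n choose Suc j) = p + q" "rat_of_nat (Suc n choose Suc (Suc j)) = q + r"
      "rat_of_nat (Suc (Suc n) choose Suc (Suc j)) = p + 2 * q + r"
      by (simp_all add: p_def q_def r_def)
    have h1: "coeff ([:1, 1:] * narayana_B (n + 2)) k = (q + r)\<^sup>2 + (p + q)\<^sup>2"
      by (simp add: 3 coeff_pCons coeff_narayana_B c1 del: binomial_Suc_Suc)
    have h2: "coeff ([:1, -2, 1:] * narayana_B (n + 1)) k = r\<^sup>2 - 2 * q\<^sup>2 + p\<^sup>2"
      by (simp add: 3 coeff_pCons coeff_narayana_B p_def q_def r_def del: binomial_Suc_Suc)
    have h3: "coeff (narayana_B (n + 3)) k = (p + 2 * q + r)\<^sup>2"
      by (simp add: 3 B c1 del: binomial_Suc_Suc)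
    show ?thesis unfolding coeff_diff coeff_smult h1 h2 h3 using main by (simp add: add.commute)
  qed
qed

text \<open>Coefficient \<open>m + 1\<close> of \<open>V\<close> is determined by the lower ones, as
  \<open>m + 1\<close> is invertible in characteristic zero.\<close>

lemma fps_linear_ode_unique:
  fixes V K :: "'a::field_char_0 fps"
  assumes "fps_deriv V = K * V" "V $ 0 = 0"
  shows "V = 0"
proof (rule fps_ext)
  fix n
  show "V $ n = 0 $ n"
  proof (induction n rule: less_induct)
    case (less n)
    show ?case
    proof (cases n)
      case (Suc m)
      have "of_nat (Suc m) * V $ Suc m = (K * V) $ m" using assms(1) by (metis fps_deriv_nth Suc_eq_plus1)
      also have "\<dots> = 0" using less Suc by (simp add: fps_mult_nth)
      finally show ?thesis using Suc by (simp del: of_nat_Suc)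
    qed (use assms in simp)
  qed
qed

text \<open>The counterpart of the Legendre generating function. The three-term recurrence amounts
  to \<open>2 * \<Delta> * B' = - \<Delta>' * B\<close>, so \<open>B^2 * \<Delta>\<close> has
  derivative zero and equals its constant coefficient.\<close>

lemma narayana_B_fps_square:
  fixes x :: rat
  defines "B \<equiv> Abs_fps (\<lambda>n. poly (narayana_B (Suc n)) x)" and "\<xi> \<equiv> fps_const x"
  shows "B\<^sup>2 * (1 - 2 * (1 + \<xi>) * fps_X + (1 - \<xi>)\<^sup>2 * fps_X\<^sup>2) = 1"
proof -
  define \<Delta> where "\<Delta> = 1 - 2 * (1 + \<xi>) * fps_X + (1 - \<xi>)\<^sup>2 * fps_X\<^sup>2"
  have B01: "B $ 0 = 1" "B $ Suc 0 = 1 + x"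
    by (simp_all add: B_def narayana_B_def poly_monom numeral_2_eq_2)
  have rec: "of_nat (n + 2) * B $ (n + 2) = of_nat (2 * n + 3) * (1 + x) * B $ (n + 1) - of_nat (n + 1) * (1 - x)\<^sup>2 * B $ n" for n
    using arg_cong[OF narayana_B_rec[of n], of "\<lambda>p. poly p x"]
    by (simp add: B_def numeral_3_eq_3 power2_eq_square algebra_simps)
  \<comment> \<open>Coefficient \<open>n \<ge> 1\<close> is \<open>rec\<close> at
    \<open>n - 1\<close>; coefficient \<open>0\<close> comes from the initial values
    \<open>B01\<close>.\<close>
  have ode: "\<Delta> * fps_deriv B = (1 + \<xi> - (1 - \<xi>)\<^sup>2 * fps_X) * B"
  proof (rule fps_ext)
    fix n
    have l: "\<Delta> * fps_deriv B = fps_deriv B - fps_const (2 * (1 + x)) * (fps_X * fps_deriv B)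
      + fps_const ((1 - x)\<^sup>2) * (fps_X * (fps_X * fps_deriv B))"
      by (simp add: \<Delta>_def \<xi>_def algebra_simps power2_eq_square
        flip: fps_const_add fps_const_sub fps_const_mult fps_numeral_fps_const)
    have r: "(1 + \<xi> - (1 - \<xi>)\<^sup>2 * fps_X) * B = fps_const (1 + x) * B - fps_const ((1 - x)\<^sup>2) * (fps_X * B)"
      by (simp add: \<xi>_def algebra_simps power2_eq_square
        flip: fps_const_add fps_const_sub fps_const_mult fps_numeral_fps_const)
    consider "n = 0" | "n = 1" | m where "n = Suc (Suc m)" by (metis One_nat_def not0_implies_Suc)
    then show "(\<Delta> * fps_deriv B) $ n = ((1 + \<xi> - (1 - \<xi>)\<^sup>2 * fps_X) * B) $ n"
    proof cases
      case 1
      then show ?thesis unfolding l r by (simp add: B01)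
    next
      case 2
      then show ?thesis unfolding l r using rec[of 0] by (simp add: B01 algebra_simps power2_eq_square numeral_2_eq_2)
    next
      case (3 m)
      then show ?thesis unfolding l r fps_sub_nth fps_add_nth fps_mult_left_const_nth using rec[of "Suc m"] by (simp add: algebra_simps)
    qed
  qed
  have dD: "fps_deriv \<Delta> = - 2 * (1 + \<xi> - (1 - \<xi>)\<^sup>2 * fps_X)"
    by (simp add: \<Delta>_def \<xi>_def power2_eq_square algebra_simps)
  have "fps_deriv (B\<^sup>2 * \<Delta>) = 2 * B * (\<Delta> * fps_deriv B) + B\<^sup>2 * fps_deriv \<Delta>"
    by (simp add: power2_eq_square algebra_simps)
  also have "\<dots> = 0" unfolding ode dD by (simp add: power2_eq_square algebra_simps)
  finally have "B\<^sup>2 * \<Delta> = fps_const ((B\<^sup>2 * \<Delta>) $ 0)"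
    by (simp only: fps_deriv_eq_0_iff)
  also have "(B\<^sup>2 * \<Delta>) $ 0 = 1" by (simp add: power2_eq_square B01 \<Delta>_def \<xi>_def)
  finally show ?thesis by (simp add: \<Delta>_def)
qed


text \<open>
  Both \<open>D = z C(z)\<close> and \<open>a(\<beta>) / (1 + x a(\<beta>))\<close> solve \<open>y' = \<beta>' (1 + (1 - x) y)\<close> with \<open>y(0) = 0\<close>.
\<close>

lemma eulerian_fps_compose:
  fixes x :: rat and A :: "nat \<Rightarrow> rat"
  defines "\<xi> \<equiv> fps_const x"
    and "\<beta> \<equiv> Abs_fps (\<lambda>n. if n = 0 then 0 else poly (narayana_B n) x / of_nat n)"
    and "a \<equiv> Abs_fps (\<lambda>n. if n = 0 then 0 else A n / fact n)"
  assumes A0: "A 0 = 1"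
    and A_rec: "\<And>n. A (Suc n) = (\<Sum>i\<le>n. of_nat (n choose i) * (A (n - i) * (if i = 0 then 1 else x) * A i))"
    and C: "C * (1 - fps_X - fps_X * \<xi> * C) = 1 - fps_X * \<xi> * C"
  shows "(a oo \<beta>) * (1 - \<xi> * (fps_X * C)) = fps_X * C"
proof -
  define D where "D = fps_X * C"
  define \<alpha> where "\<alpha> = a oo \<beta>"
  \<comment> \<open>\<open>S\<close> is a square root of the discriminant of the quadratic equation
    \<open>quad\<close> for \<open>D\<close>. By \<open>S2\<close> this discriminant is the factor
    in \<open>narayana_B_fps_square\<close>, which links \<open>S\<close> to the derivative of
    \<beta>.\<close>
  define S where "S = 1 - (1 - \<xi>) * fps_X - 2 * \<xi> * D"
  have D0: "D $ 0 = 0" by (simp add: D_def)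
  have \<beta>0: "\<beta> $ 0 = 0" by (simp add: \<beta>_def)
  have quad: "\<xi> * D\<^sup>2 - (1 - (1 - \<xi>) * fps_X) * D + fps_X = 0"
  proof -
    have "\<xi> * D\<^sup>2 - (1 - (1 - \<xi>) * fps_X) * D + fps_X =
        - fps_X * (C * (1 - fps_X - fps_X * \<xi> * C) - (1 - fps_X * \<xi> * C))"
      by (simp add: D_def power2_eq_square algebra_simps)
    then show ?thesis by (simp add: C)
  qed
  have S2: "S\<^sup>2 = 1 - 2 * (1 + \<xi>) * fps_X + (1 - \<xi>)\<^sup>2 * fps_X\<^sup>2"
  proof -
    have "S\<^sup>2 = 1 - 2 * (1 + \<xi>) * fps_X + (1 - \<xi>)\<^sup>2 * fps_X\<^sup>2
        + 4 * \<xi> * (\<xi> * D\<^sup>2 - (1 - (1 - \<xi>) * fps_X) * D + fps_X)"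
      by (simp add: S_def power2_eq_square algebra_simps)
    then show ?thesis by (simp add: quad)
  qed
  have d\<beta>: "fps_deriv \<beta> = Abs_fps (\<lambda>n. poly (narayana_B (Suc n)) x)"
    by (rule fps_ext) (simp add: \<beta>_def del: of_nat_Suc)
  have "(fps_deriv \<beta>)\<^sup>2 * S\<^sup>2 = 1"
    unfolding S2 d\<beta> \<xi>_def by (rule narayana_B_fps_square)
  then have "(fps_deriv \<beta> * S - 1) * (fps_deriv \<beta> * S + 1) = 0"
    by (simp add: power2_eq_square algebra_simps)
  \<comment> \<open>The squares leave a sign open; the constant coefficient of
    \<open>\<beta>' * S\<close> is 1, which rules out \<open>-1\<close>.\<close>
  moreover have "(fps_deriv \<beta> * S + 1) $ 0 \<noteq> 0"
    by (simp add: S_def D0 \<beta>_def narayana_B_def poly_monom)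
  then have "fps_deriv \<beta> * S + 1 \<noteq> 0" by force
  ultimately have \<beta>S: "fps_deriv \<beta> * S = 1" by simp
  \<comment> \<open>Differentiating \<open>quad\<close> makes \<open>S\<close> appear as the factor
    of \<open>D'\<close>, and \<open>\<beta>' * S = 1\<close> then yields the linear equation for
    \<open>D\<close>.\<close>
  have "fps_deriv (\<xi> * D\<^sup>2 - (1 - (1 - \<xi>) * fps_X) * D + fps_X) = (1 + (1 - \<xi>) * D) - fps_deriv D * S"
    by (simp add: S_def \<xi>_def power2_eq_square algebra_simps)
  then have DS: "fps_deriv D * S = 1 + (1 - \<xi>) * D" by (simp add: quad)
  have "fps_deriv D = fps_deriv D * (fps_deriv \<beta> * S)" by (simp add: \<beta>S)
  also have "\<dots> = fps_deriv \<beta> * (fps_deriv D * S)" by (simp add: mult_ac)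
  finally have D': "fps_deriv D = fps_deriv \<beta> * (1 + (1 - \<xi>) * D)" by (simp add: DS)
  have one_a: "1 + a = Abs_fps (\<lambda>n. A n / fact n)"
    by (rule fps_ext) (simp add: a_def A0)
  have one_xa: "1 + \<xi> * a = Abs_fps (\<lambda>n. (if n = 0 then 1 else x) * A n / fact n)"
    by (rule fps_ext) (simp add: a_def A0 \<xi>_def)
  \<comment> \<open>\<open>A_rec\<close> is a binomial convolution, hence a product of exponential
    generating functions; the weight depending on \<open>i = 0\<close> turns one factor
    \<open>1 + a\<close> into \<open>1 + \<xi> * a\<close>.\<close>
  have a': "fps_deriv a = (1 + a) * (1 + \<xi> * a)"
  proof (rule fps_ext)
    fix n
    have "fps_deriv a $ n = A (Suc n) / fact n"
      by (simp add: a_def field_simps del: of_nat_Suc)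
    also have "\<dots> = (\<Sum>i\<le>n. ((if i = 0 then 1 else x) * A i / fact i) * (A (n - i) / fact (n - i)))"
      unfolding A_rec sum_divide_distrib
    proof (intro sum.cong refl)
      fix i assume "i \<in> {..n}"
      then have "rat_of_nat (n choose i) = fact n / (fact i * fact (n - i))"
        by (simp add: binomial_fact)
      then show "of_nat (n choose i) * (A (n - i) * (if i = 0 then 1 else x) * A i) / fact n =
        ((if i = 0 then 1 else x) * A i / fact i) * (A (n - i) / fact (n - i))"
        by (simp add: field_simps)
    qed
    also have "\<dots> = ((1 + \<xi> * a) * (1 + a)) $ n"
      unfolding one_a one_xa by (simp add: fps_mult_nth atMost_atLeast0)
    finally show "fps_deriv a $ n = ((1 + a) * (1 + \<xi> * a)) $ n" by (simp add: mult.commute)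
  qed
  have \<xi>c: "\<xi> oo \<beta> = \<xi>" by (simp add: \<xi>_def)
  have \<alpha>': "fps_deriv \<alpha> = fps_deriv \<beta> * (1 + \<alpha>) * (1 + \<xi> * \<alpha>)"
    unfolding \<alpha>_def fps_compose_deriv[OF \<beta>0] a'
    by (simp add: fps_compose_mult_distrib[OF \<beta>0] fps_compose_add_distrib \<xi>c mult_ac)
  \<comment> \<open>\<open>V = 0\<close> is the equation
    \<open>D = \<alpha> / (1 + \<xi> * \<alpha>)\<close> with the denominator cleared. The equations
    for \<open>D\<close> and \<alpha> make \<open>V\<close> a solution of a homogeneous linear
    equation with zero initial value.\<close>
  define V where "V = D * (1 + \<xi> * \<alpha>) - \<alpha>"
  have "fps_deriv V = fps_deriv D * (1 + \<xi> * \<alpha>) + (\<xi> * D - 1) * fps_deriv \<alpha>"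
    by (simp add: V_def \<xi>_def algebra_simps)
  also have "\<dots> = fps_deriv \<beta> * (1 + \<xi> * \<alpha>) * V"
    unfolding D' \<alpha>' by (simp add: V_def algebra_simps)
  finally have "V = 0"
    by (rule fps_linear_ode_unique) (simp add: V_def D0 \<alpha>_def a_def)
  then show ?thesis by (simp add: V_def \<alpha>_def D_def algebra_simps)
qed

text \<open>Only the recurrences enter here. Both families turn out to satisfy
  \<open>Y k = (a oo \<beta>) * (N 0 k + \<xi> * R k Y)\<close>, where \<open>R k\<close> involves
  only indices \<open>1 \<le> j < k\<close>, so they agree by strong induction on
  \<open>k\<close>.\<close>

lemma narayana_fps_eq_compose:
  fixes x :: rat and N e :: "nat \<Rightarrow> nat \<Rightarrow> rat"
  defines "\<beta> \<equiv> Abs_fps (\<lambda>n. if n = 0 then 0 else poly (narayana_B n) x / of_nat n)"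
  assumes N00: "N 0 0 = 1"
    and A_rec: "\<And>n. N 0 (Suc n) = (\<Sum>i\<le>n. of_nat (n choose i) * (N 0 (n - i) * (if i = 0 then 1 else x) * N 0 i))"
    and N_rec: "\<And>n k. N (Suc n) k = x * (\<Sum>j\<le>k. of_nat (k choose j) * (N 0 (k - j) * N n j))
        + x * (\<Sum>r<n. N r 0 * N (n - r) k) + (1 - x) * N n k"
    and e_rec: "\<And>m k. k \<ge> 1 \<Longrightarrow> e m k = (\<Sum>p = 1..m. of_nat (m choose p) * (N 0 p *
        ((if p = m then N 0 k else 0) + x * (\<Sum>j = 1..<k. of_nat (k choose j) * (N 0 (k - j) * e (m - p) j)))))"
    and k: "k \<ge> 1"
  shows "Abs_fps (\<lambda>m. e m k / fact m) oo \<beta> = fps_X * Abs_fps (\<lambda>n. N n k)"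
proof -
  define \<xi> where "\<xi> = fps_const x"
  define F where "F = (\<lambda>k. Abs_fps (\<lambda>n. N n k))"
  define E where "E = (\<lambda>k. Abs_fps (\<lambda>m. e m k / fact m))"
  define a where "a = Abs_fps (\<lambda>n. if n = 0 then 0 else N 0 n / fact n)"
  define R where "R = (\<lambda>k f. \<Sum>j = 1..<k. fps_const (of_nat (k choose j) * N 0 (k - j)) * f j :: rat fps)"
  have \<beta>0: "\<beta> $ 0 = 0" by (simp add: \<beta>_def)
  \<comment> \<open>\<open>N_rec\<close> as a functional equation. The sum over \<open>r < n\<close>
    omits \<open>r = n\<close>, so \<open>F k\<close> enters the product with \<open>F 0\<close>
    without its constant coefficient.\<close>
  have F_eq: "F k - fps_const (N 0 k) = fps_X * (\<xi> * (\<Sum>j\<le>k. fps_const (of_nat (k choose j) * N 0 (k - j)) * F j)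
      + \<xi> * (F 0 * (F k - fps_const (N 0 k))) + (1 - \<xi>) * F k)" for k
  proof (rule fps_ext)
    fix n
    show "(F k - fps_const (N 0 k)) $ n = (fps_X * (\<xi> * (\<Sum>j\<le>k. fps_const (of_nat (k choose j) * N 0 (k - j)) * F j)
      + \<xi> * (F 0 * (F k - fps_const (N 0 k))) + (1 - \<xi>) * F k)) $ n"
    proof (cases n)
      case 0
      then show ?thesis by (simp add: F_def)
    next
      case (Suc m)
      have "(F 0 * (F k - fps_const (N 0 k))) $ m = (\<Sum>r\<le>m. N r 0 * (if r = m then 0 else N (m - r) k))"
        by (simp add: fps_mult_nth F_def atMost_atLeast0) (intro sum.cong refl, auto)
      also have "\<dots> = (\<Sum>r<m. N r 0 * N (m - r) k)"
        by (simp add: lessThan_Suc_atMost[symmetric])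
      finally have FF: "(F 0 * (F k - fps_const (N 0 k))) $ m = (\<Sum>r<m. N r 0 * N (m - r) k)" .
      have "(\<Sum>j\<le>k. fps_const (of_nat (k choose j) * N 0 (k - j)) * F j) $ m = (\<Sum>j\<le>k. of_nat (k choose j) * (N 0 (k - j) * N m j))"
        by (simp add: fps_sum_nth F_def mult.assoc)
      then show ?thesis
        using Suc FF by (simp add: \<xi>_def F_def N_rec[of m k] algebra_simps)
    qed
  qed
  have F0: "F 0 * (1 - fps_X - fps_X * \<xi> * F 0) = 1 - fps_X * \<xi> * F 0"
    using F_eq[of 0] by (simp add: N00 algebra_simps)
  \<comment> \<open>The terms \<open>j = 0\<close> and \<open>j = k\<close> are taken out of the
    sum: the first cancels the constant-coefficient correction, the second combines with
    \<open>(1 - \<xi>) * F k\<close>.\<close>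
  have Fk: "F k * (1 - fps_X - fps_X * \<xi> * F 0) = fps_const (N 0 k) + fps_X * \<xi> * R k F" if "k \<ge> 1" for k
  proof -
    have "{..k} = insert 0 (insert k {1..<k})" using that by auto
    then have "(\<Sum>j\<le>k. fps_const (of_nat (k choose j) * N 0 (k - j)) * F j) =
        fps_const (N 0 k) * F 0 + F k + R k F"
      using that by (simp add: N00 R_def)
    then show ?thesis using F_eq[of k] by (simp add: algebra_simps)
  qed
  define D where "D = fps_X * F 0"
  have \<alpha>: "(a oo \<beta>) * (1 - \<xi> * D) = D"
    unfolding D_def a_def \<beta>_def \<xi>_def
    by (rule eulerian_fps_compose) (use N00 A_rec F0 in \<open>simp_all add: \<xi>_def\<close>)
  have H: "fps_X * F k = (a oo \<beta>) * (fps_const (N 0 k) + \<xi> * R k (\<lambda>j. fps_X * F j))" if "k \<ge> 1" for k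
  proof -
    have RX: "R k (\<lambda>j. fps_X * F j) = fps_X * R k F"
      by (simp add: R_def sum_distrib_left mult_ac)
    \<comment> \<open>By \<open>F0\<close>, the series \<open>1 - \<xi> * D\<close> is
      \<open>F 0\<close> times the factor of \<open>F k\<close> in \<open>Fk\<close>. With
      \<open>D\<close> rewritten by \<alpha>, the series \<open>1 - \<xi> * D\<close> stands on both
      sides and cancels, its constant coefficient being 1.\<close>
    have "(1 - \<xi> * D) * (fps_X * F k) = fps_X * F k * (F 0 * (1 - fps_X - fps_X * \<xi> * F 0))"
      unfolding F0 by (simp add: D_def algebra_simps)
    also have "\<dots> = D * (F k * (1 - fps_X - fps_X * \<xi> * F 0))" by (simp add: D_def mult_ac)
    also have "\<dots> = D * (fps_const (N 0 k) + \<xi> * R k (\<lambda>j. fps_X * F j))"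
      unfolding Fk[OF that] RX by (simp add: mult_ac)
    also have "\<dots> = (1 - \<xi> * D) * ((a oo \<beta>) * (fps_const (N 0 k) + \<xi> * R k (\<lambda>j. fps_X * F j)))"
      by (subst \<alpha>[symmetric]) (simp only: mult_ac)
    finally have eq: "(1 - \<xi> * D) * (fps_X * F k) = (1 - \<xi> * D) * ((a oo \<beta>) * (fps_const (N 0 k) + \<xi> * R k (\<lambda>j. fps_X * F j)))" .
    have "(1 - \<xi> * D) $ 0 = 1" by (simp add: D_def)
    then have "1 - \<xi> * D \<noteq> 0" by force
    then show ?thesis using eq by simp
  qed
  have E_eq: "E k = a * (fps_const (N 0 k) + \<xi> * R k E)" if "k \<ge> 1" for k
  proof (rule fps_ext)
    fix m
    let ?y = "\<lambda>p. (if p = m then N 0 k else 0) + x * (\<Sum>j = 1..<k. of_nat (k choose j) * (N 0 (k - j) * e (m - p) j))"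
    have "E k $ m = (\<Sum>p = 1..m. (N 0 p / fact p) * (?y p / fact (m - p)))"
      unfolding E_def e_rec[OF that] fps_nth_Abs_fps sum_divide_distrib
    proof (intro sum.cong refl)
      fix p assume "p \<in> {1..m}"
      then have "rat_of_nat (m choose p) = fact m / (fact p * fact (m - p))"
        by (simp add: binomial_fact)
      then show "of_nat (m choose p) * (N 0 p * ?y p) / fact m = (N 0 p / fact p) * (?y p / fact (m - p))"
        by simp
    qed
    \<comment> \<open>The index \<open>p = 0\<close> may be added because \<open>a\<close> has
      constant coefficient zero.\<close>
    also have "\<dots> = (\<Sum>p = 0..m. a $ p * (fps_const (N 0 k) + \<xi> * R k E) $ (m - p))"
    proof (rule sum.mono_neutral_cong_left)
      fix p assume p: "p \<in> {1..m}"
      have "?y p / fact (m - p) = (fps_const (N 0 k) + \<xi> * R k E) $ (m - p)"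
        using p by (simp add: \<xi>_def R_def fps_sum_nth E_def add_divide_distrib sum_divide_distrib sum_distrib_left mult.assoc)
      then show "(N 0 p / fact p) * (?y p / fact (m - p)) = a $ p * (fps_const (N 0 k) + \<xi> * R k E) $ (m - p)"
        using p by (simp add: a_def)
    qed (auto simp: a_def)
    finally show "E k $ m = (a * (fps_const (N 0 k) + \<xi> * R k E)) $ m"
      by (simp add: fps_mult_nth)
  qed
  have "E k oo \<beta> = fps_X * F k" if "k \<ge> 1" for k
    using that
  proof (induction k rule: less_induct)
    case (less k)
    have "R k E oo \<beta> = R k (\<lambda>j. fps_X * F j)"
      unfolding R_def fps_compose_sum_distrib
    proof (intro sum.cong refl)
      fix j assume "j \<in> {1..<k}"
      then show "(fps_const (of_nat (k choose j) * N 0 (k - j)) * E j) oo \<beta> =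
          fps_const (of_nat (k choose j) * N 0 (k - j)) * (fps_X * F j)"
        using less.IH[of j] by (simp add: fps_compose_mult_distrib[OF \<beta>0])
    qed
    then have "E k oo \<beta> = (a oo \<beta>) * (fps_const (N 0 k) + \<xi> * R k (\<lambda>j. fps_X * F j))"
      unfolding E_eq[OF less.prems]
      by (simp add: fps_compose_mult_distrib[OF \<beta>0] fps_compose_add_distrib \<xi>_def)
    then show ?case using H[OF less.prems] by simp
  qed
  from this[OF k] show ?thesis by (simp add: E_def F_def)
qed

section \<open>The theorem as an identity of coefficients\<close>

lemma num_cycles_eq_card_orbits: "num_cycles n w = card (orbit w ` {1..n})"
  by (simp add: num_cycles_def cycle_type_def)

lemma B_perm_eq_prod_orbits: "B_perm n w = (\<Prod>C\<in>orbit w ` {1..n}. narayana_B (card C))"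
  by (simp add: B_perm_def cycle_type_def image_mset.compositionality comp_def prod_unfold_prod_mset)

theorem corollary5p7:
  fixes n k :: nat
  assumes "n \<ge> 1" and "k \<ge> 1"
  shows "N_poly (n - 1) k =
    smult (1 / fact n) (\<Sum>w\<in>sym_group n. B_perm n w * E_poly (num_cycles n w) k)"
proof (rule poly_eq_poly_eq_iff[THEN iffD1], rule ext)
  \<comment> \<open>A rational polynomial is determined by its values, so the identity is proved at
    a fixed \<open>x\<close>.\<close>
  fix x :: rat
  let ?\<beta> = "Abs_fps (\<lambda>n. if n = 0 then 0 else poly (narayana_B n) x / of_nat n)"
  have "(\<Sum>w\<in>sym_group n. poly (B_perm n w * E_poly (num_cycles n w) k) x) =
      cycle_sum (\<lambda>n. poly (narayana_B n) x) (\<lambda>l. alt_numb x l k) {1..n}"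
    by (simp add: cycle_sum_def sym_group_def B_perm_eq_prod_orbits num_cycles_eq_card_orbits
      poly_prod poly_E_poly[OF assms(2)])
  also have "\<dots> = fact n * (Abs_fps (\<lambda>m. alt_numb x m k / fact m) oo ?\<beta>) $ n"
    by (subst cycle_sum_fps) simp_all
  also have "Abs_fps (\<lambda>m. alt_numb x m k / fact m) oo ?\<beta> = fps_X * Abs_fps (\<lambda>n. stack_numb x n k)"
  proof (rule narayana_fps_eq_compose[where N = "stack_numb x" and e = "alt_numb x"])
    show "stack_numb x 0 (Suc n) = (\<Sum>i\<le>n. of_nat (n choose i) *
        (stack_numb x 0 (n - i) * (if i = 0 then 1 else x) * stack_numb x 0 i))" for n
      by (subst stack_numb_rec) simp
    show "stack_numb x (Suc n) k = x * (\<Sum>j\<le>k. of_nat (k choose j) * (stack_numb x 0 (k - j) * stack_numb x n j))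
        + x * (\<Sum>r<n. stack_numb x r 0 * stack_numb x (n - r) k) + (1 - x) * stack_numb x n k" for n k
      by (subst stack_numb_rec) simp
    show "k \<ge> 1" by (rule assms(2))
  qed (simp_all add: stack_numb_0_0 alt_numb_rec alt_rhs_def)
  \<comment> \<open>The factor \<open>fps_X\<close> shifts the index by one, which is where
    \<open>n - 1\<close> comes from.\<close>
  also have "fact n * (fps_X * Abs_fps (\<lambda>n. stack_numb x n k)) $ n = fact n * stack_numb x (n - 1) k"
    using assms(1) by simp
  finally show "poly (N_poly (n - 1) k) x =
      poly (smult (1 / fact n) (\<Sum>w\<in>sym_group n. B_perm n w * E_poly (num_cycles n w) k)) x"
    by (simp add: poly_N_poly poly_sum)
qed

end
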